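(* Let $n>1$ be an integer and let $J,K,L,M\in\mathbb{R}^n$ satisfy $|JK|=|LM|$. Then there exists a finite set $C_{JKLM}\subseteq\mathbb{R}^n$ containing $J,K,L,M$ such that every map $f:C_{JKLM}\to\mathbb{R}^n$ that preserves unit distance satisfies $|f(J)f(K)|=|f(L)f(M)|$. Moreover, if $J,K,L,M\in\mathbf{F}^n$, then $C_{JKLM}$ can be chosen to be a subset of $\mathbf{F}^n$.
   Context: For points $P,Q\in\mathbb{R}^n$, $|PQ|=|P-Q|$ is their Euclidean distance. $\mathbf{F}\subseteq\mathbb{R}$ denotes the field of real numbers constructible by means of ruler and compass (equivalently, the smallest subfield of $\mathbb{R}$ closed under taking square roots of its non-negative elements). A map $f:S\to\mathbb{R}^n$ with $S\subseteq\mathbb{R}^n$ preserves unit distance if for all $u,v\in S$, $|u-v|=1$ implies $|f(u)-f(v)|=1$. Maps are arbitrary functions (no continuity or injectivity is assumed). The points $J,K,L,M$ are not assumed to be distinct. *)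

theory Defs
  imports "HOL-Analysis.Analysis"
begin

text \<open>
  The ruler-and-compass constructible reals, as the smallest subfield of the reals
  that is closed under square roots of non-negative elements.
\<close>

inductive_set constructible :: "real set" where
  zero: "0 \<in> constructible"
| one: "1 \<in> constructible"
| add: "x \<in> constructible \<Longrightarrow> y \<in> constructible \<Longrightarrow> x + y \<in> constructible"
| uminus: "x \<in> constructible \<Longrightarrow> - x \<in> constructible"
| mult: "x \<in> constructible \<Longrightarrow> y \<in> constructible \<Longrightarrow> x * y \<in> constructible"
| inverse: "x \<in> constructible \<Longrightarrow> x \<noteq> 0 \<Longrightarrow> inverse x \<in> constructible"
| sqrt: "x \<in> constructible \<Longrightarrow> 0 \<le> x \<Longrightarrow> sqrt x \<in> constructible"

definition constructible_points :: "(real ^ 'n) set" where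
  "constructible_points = {P. \<forall>i. P $ i \<in> constructible}"

text \<open>
  A map on \<open>S\<close> is represented by a total function of which only the values on \<open>S\<close> matter.
\<close>

definition preserves_unit_distance_on ::
  "(real ^ 'n) set \<Rightarrow> (real ^ 'n \<Rightarrow> real ^ 'n) \<Rightarrow> bool" where
  "preserves_unit_distance_on S f \<longleftrightarrow>
     (\<forall>u\<in>S. \<forall>v\<in>S. dist u v = 1 \<longrightarrow> dist (f u) (f v) = 1)"

end

theory Submission
  imports Defs
begin

text \<open>
  Fix a subfield of the reals closed under square roots and let \<open>W\<close> be the set of points with
  coordinates in it. Call a statement about a map \<open>f\<close> forced if it follows from finitely many
  unit distances within \<open>W\<close>; forced statements are closed under finite conjunction and consequence,
  so they form a filter. Gluing two regular simplices along a facet forces the distance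
  \<open>\<lambda> = sqrt (2 + 2/n)\<close>, and with the triangle of sides \<open>1\<close>, \<open>\<lambda>\<close> it forces \<open>f x \<noteq> f y\<close> for
  medium distances. For \<open>n \<ge> 3\<close> a cross-polytope then forces the distance \<open>sqrt 2\<close>, hence squares,
  and squares orthogonal to a unit rhombus force its image to be planar. So unit rhombi go to
  planar rhombi, and additivity of \<open>\<phi> v = f v - f 0\<close> is forced.

  Since \<open>\<phi>\<close> preserves rational lengths, \<open>\<phi> (a p)\<close> is perpendicular to \<open>\<phi> (s q)\<close> for orthonormal
  \<open>p\<close>, \<open>q\<close> whenever \<open>sqrt (a\<^sup>2 + s\<^sup>2)\<close> is rational. Hence \<open>\<phi> (a p)\<close> and \<open>\<phi> (b p)\<close> are
  parallel if \<open>b\<^sup>2 = a\<^sup>2 + 1\<close>. The set of \<open>c\<close> with \<open>\<phi> (c p)\<close> parallel to \<open>\<phi> (r p)\<close> is thus closed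
  under \<open>\<rat>\<close>-linear combinations, inverses and \<open>a \<mapsto> sqrt (a\<^sup>2 + 1)\<close>, and a computation with
  rational functions of \<open>r\<close> shows that it contains 1. So \<open>\<phi>\<close> maps lines through 0 into lines and
  preserves orthogonality; finally \<open>norm a = norm b\<close> means that \<open>a + b\<close> is orthogonal to \<open>a - b\<close>.
\<close>

subsection \<open>Euclidean geometry\<close>

text \<open>The index type has as many elements as the dimension, so a nonzero \<open>z\<close>
  would give \<open>n + 1\<close> independent vectors. This count stands in for orthogonal
  complements throughout.\<close>

lemma orthogonal_to_orthogonal_family:
  fixes z :: "real ^ 'n" and Y :: "'n \<Rightarrow> real ^ 'n"
  assumes nz: "\<And>i. Y i \<noteq> 0" and orth: "\<And>i j. i \<noteq> j \<Longrightarrow> Y i \<bullet> Y j = 0"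
    and z: "\<And>i. z \<bullet> Y i = 0"
  shows "z = 0"
proof (rule ccontr)
  assume "z \<noteq> 0"
  have inj: "inj Y"
    by (metis inj_onI inner_eq_zero_iff nz orth)
  have notin: "z \<notin> range Y"
    using z \<open>z \<noteq> 0\<close> by (metis imageE inner_eq_zero_iff)
  have "pairwise orthogonal (insert z (range Y))"
    unfolding pairwise_def orthogonal_def using orth z by (auto simp: inner_commute) metis
  moreover have "0 \<notin> insert z (range Y)"
    using nz \<open>z \<noteq> 0\<close> by (metis imageE insertE)
  ultimately have "independent (insert z (range Y))"
    by (rule pairwise_orthogonal_independent)
  then have "card (insert z (range Y)) \<le> CARD('n)"
    using independent_bound by fastforce
  moreover have "card (insert z (range Y)) = Suc CARD('n)"
    using inj notin by (simp add: card_image)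
  ultimately show False by simp
qed

text \<open>Subtract from \<open>a\<close> its projection on \<open>b\<close>; the rest is
  orthogonal to the family with \<open>b\<close> put in the free slot \<open>i\<close>.\<close>

lemma parallel_if_orthogonal_family:
  fixes a b :: "real ^ 'n" and Y :: "'n \<Rightarrow> real ^ 'n"
  assumes nz: "\<And>k. k \<noteq> i \<Longrightarrow> Y k \<noteq> 0"
    and orth: "\<And>k l. k \<noteq> l \<Longrightarrow> k \<noteq> i \<Longrightarrow> l \<noteq> i \<Longrightarrow> Y k \<bullet> Y l = 0"
    and a: "\<And>k. k \<noteq> i \<Longrightarrow> a \<bullet> Y k = 0" and b: "\<And>k. k \<noteq> i \<Longrightarrow> b \<bullet> Y k = 0" and "b \<noteq> 0"
  shows "\<exists>c. a = c *\<^sub>R b"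
proof -
  define z where "z = a - (a \<bullet> b / (b \<bullet> b)) *\<^sub>R b"
  have "z = 0"
  proof (rule orthogonal_to_orthogonal_family[where Y = "Y(i := b)"])
    show "(Y(i := b)) k \<noteq> 0" for k using nz \<open>b \<noteq> 0\<close> by auto
    show "(Y(i := b)) k \<bullet> (Y(i := b)) l = 0" if "k \<noteq> l" for k l
      using that orth b by (auto simp: inner_commute)
    show "z \<bullet> (Y(i := b)) k = 0" for k
      using a b \<open>b \<noteq> 0\<close> by (auto simp: z_def inner_diff_left)
  qed
  then show ?thesis by (auto simp: z_def)
qed

lemma dist_eq_1_iff: "dist x y = 1 \<longleftrightarrow> (x - y) \<bullet> (x - y) = 1"
  for x y :: "'a::real_inner"
  by (simp add: dist_norm norm_eq_1)

lemma norm_add_diff_orthogonal: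
  fixes a b :: "'a::real_inner"
  assumes "norm (a + b) = norm (a - b)"
  shows "a \<bullet> b = 0"
proof -
  have "(a + b) \<bullet> (a + b) = (a - b) \<bullet> (a - b)"
    using assms by (simp add: norm_eq)
  then show ?thesis
    by (simp add: algebra_simps inner_commute)
qed

text \<open>
  The vertices \<open>\<sigma> i\<close> and \<open>p\<close> form a regular simplex; \<open>q - p\<close> is forced to be a multiple of
  \<open>m = (\<Sum>i. \<sigma> i - p)\<close>, because it has equal inner products with all edges at \<open>p\<close>.
\<close>

lemma simplex_apex_dist:
  fixes p q :: "real ^ 'n" and \<sigma> :: "'n \<Rightarrow> real ^ 'n"
  assumes p: "\<And>i. dist p (\<sigma> i) = 1" and q: "\<And>i. dist q (\<sigma> i) = 1"
    and s: "\<And>i j. i \<noteq> j \<Longrightarrow> dist (\<sigma> i) (\<sigma> j) = 1"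
  shows "p = q \<or> dist p q = sqrt (2 + 2 / real CARD('n))"
proof -
  define n where "n = real CARD('n)"
  have n: "n \<ge> 1" unfolding n_def by (simp add: Suc_leI)
  define x where "x i = \<sigma> i - p" for i
  define m where "m = (\<Sum>i\<in>UNIV. x i)"
  define d where "d = q - p"
  have x1: "x i \<bullet> x i = 1" for i
    using p[of i] by (simp add: x_def dist_eq_1_iff dist_commute[of p])
  have x2: "x i \<bullet> x j = 1 / 2" if "i \<noteq> j" for i j
  proof -
    have "(x i - x j) \<bullet> (x i - x j) = 1"
      using s[OF that] by (simp add: x_def dist_eq_1_iff)
    then show ?thesis
      using x1[of i] x1[of j] by (simp add: inner_diff_left inner_diff_right inner_commute)
  qed
  have x: "x i \<bullet> x j = 1 / 2 + (if j = i then 1 / 2 else 0)" for i j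
    using x1 x2 by auto
  have xm: "x i \<bullet> m = (n + 1) / 2" for i
    unfolding m_def inner_sum_right x by (simp add: sum.distrib n_def add_divide_distrib)
  have mx: "m \<bullet> x i = (n + 1) / 2" for i using xm[of i] by (simp add: inner_commute)
  have mm: "m \<bullet> m = n * (n + 1) / 2"
    by (subst m_def) (simp add: inner_sum_left xm n_def)
  have dx: "d \<bullet> x i = (d \<bullet> d) / 2" for i
  proof -
    have "(d - x i) \<bullet> (d - x i) = 1"
      using q[of i] by (simp add: x_def d_def dist_eq_1_iff)
    then show ?thesis
      using x1[of i] by (simp add: inner_diff_left inner_diff_right inner_commute)
  qed
  \<comment> \<open>This \<open>t\<close> gives \<open>t m\<close> the same inner products with the
    edges \<open>x i\<close> as \<open>d\<close>.\<close>
  define t where "t = (d \<bullet> d) / (n + 1)"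
  \<comment> \<open>The edges need not be orthogonal, so \<open>sqrt 2 x i\<close> is shifted along
    \<open>m\<close>; \<open>k\<close> is a root of the quadratic that makes the resulting
    \<open>Y\<close> orthonormal.\<close>
  define r where "r = sqrt (n + 1)"
  have r: "r\<^sup>2 = n + 1" "r > 0" using n by (auto simp: r_def)
  define h where "h = (1 + 1 / r) / n"
  define k where "k = sqrt 2 * h"
  have k: "k\<^sup>2 * (n * (n + 1) / 2) - sqrt 2 * (n + 1) * k + 1 = 0"
  proof -
    have nh: "n * h * r = r + 1" using n r(2) by (simp add: h_def field_simps)
    have "n * (h\<^sup>2 * (n * r\<^sup>2) - 2 * r\<^sup>2 * h + 1) = (n * h * r)\<^sup>2 - 2 * r * (n * h * r) + n"
      by (simp add: power2_eq_square algebra_simps)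
    also have "\<dots> = 0"
      unfolding nh using r(1) by (simp add: power2_eq_square algebra_simps)
    finally have "h\<^sup>2 * (n * r\<^sup>2) - 2 * r\<^sup>2 * h + 1 = 0" using n by simp
    then show ?thesis
      unfolding r(1) by (simp add: k_def power_mult_distrib field_simps)
  qed
  define Y where "Y i = sqrt 2 *\<^sub>R x i - k *\<^sub>R m" for i
  have YY: "Y i \<bullet> Y j = (if i = j then 1 else 0)" for i j
  proof -
    have "Y i \<bullet> Y j = 2 * (x i \<bullet> x j) - sqrt 2 * (n + 1) * k + k\<^sup>2 * (n * (n + 1) / 2)"
      by (simp add: Y_def inner_diff_left inner_diff_right xm mx mm
          power2_eq_square right_diff_distrib) (simp add: algebra_simps)
    then show ?thesis unfolding x using k by auto
  qed
  have "d - t *\<^sub>R m = 0"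
  proof (rule orthogonal_to_orthogonal_family[where Y = Y])
    show "Y i \<noteq> 0" for i using YY[of i i] by auto
    show "i \<noteq> j \<Longrightarrow> Y i \<bullet> Y j = 0" for i j using YY by simp
    have zx: "(d - t *\<^sub>R m) \<bullet> x i = 0" for i
      using n by (simp add: inner_diff_left dx mx t_def)
    then have "(d - t *\<^sub>R m) \<bullet> m = 0"
      by (subst (2) m_def) (simp add: inner_sum_right)
    then show "(d - t *\<^sub>R m) \<bullet> Y i = 0" for i
      using zx by (simp add: Y_def inner_diff_right)
  qed
  then have "d \<bullet> d = t\<^sup>2 * (n * (n + 1) / 2)"
    by (simp add: mm power2_eq_square)
  also have "\<dots> = (d \<bullet> d) * ((d \<bullet> d) * n / (2 * (n + 1)))"
    using n by (simp add: t_def power2_eq_square divide_simps)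
  finally have "d \<bullet> d = 0 \<or> (d \<bullet> d) * n / (2 * (n + 1)) = 1"
    by (metis mult_cancel_left2)
  then have "d = 0 \<or> d \<bullet> d = 2 + 2 / n"
    using n by (auto simp: divide_simps algebra_simps)
  moreover have "dist p q = norm d" by (simp add: d_def dist_norm norm_minus_commute)
  ultimately show ?thesis
    unfolding norm_eq_sqrt_inner n_def by (metis d_def right_minus_eq)
qed

text \<open>Reflection in the hyperplane orthogonal to \<open>c\<close>, and the identity for
  \<open>c = 0\<close>. The formula uses only field operations, so configurations can be moved
  without leaving \<open>W\<close>.\<close>

definition householder :: "'a::real_inner \<Rightarrow> 'a \<Rightarrow> 'a" where
  "householder c x = x - (2 * (c \<bullet> x) / (c \<bullet> c)) *\<^sub>R c"

lemma householder_inner: "householder c x \<bullet> householder c y = x \<bullet> y"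
  by (cases "c = 0")
    (auto simp: householder_def inner_diff_left inner_diff_right inner_commute divide_simps)

lemma householder_linear:
  "householder c (x + y) = householder c x + householder c y"
  "householder c (a *\<^sub>R x) = a *\<^sub>R householder c x"
  "householder c (x - y) = householder c x - householder c y"
  by (auto simp: householder_def inner_add_right inner_diff_right add_divide_distrib diff_divide_distrib
      algebra_simps)

lemma householder_involution: "householder c (householder c x) = x"
  by (cases "c = 0") (auto simp: householder_def inner_diff_right algebra_simps)

lemma householder_orthogonal: "c \<bullet> x = 0 \<Longrightarrow> householder c x = x"
  by (simp add: householder_def)

lemma householder_diff:
  assumes "norm a = norm b"
  shows "householder (a - b) a = b"
proof (cases "a = b")
  case False
  have ab: "a \<bullet> a = b \<bullet> b" using assms by (simp add: norm_eq)
  then have "(a - b) \<bullet> (a - b) = 2 * ((a - b) \<bullet> a)"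
    by (simp add: inner_diff_left inner_diff_right inner_commute)
  moreover have "(a - b) \<bullet> (a - b) \<noteq> 0" using False by simp
  ultimately show ?thesis by (simp add: householder_def)
qed (simp add: householder_def)

text \<open>
  Three mutually orthogonal diagonals have squared lengths with pairwise sum 4; hence each is 2.
\<close>

lemma cross_polytope_diagonal:
  fixes x y :: "'n \<Rightarrow> real ^ 'n"
  assumes card: "CARD('n) \<ge> 3" and nz: "\<And>k. x k \<noteq> y k"
    and xx: "\<And>k l. k \<noteq> l \<Longrightarrow> dist (x k) (x l) = 1" and yy: "\<And>k l. k \<noteq> l \<Longrightarrow> dist (y k) (y l) = 1"
    and xy: "\<And>k l. k \<noteq> l \<Longrightarrow> dist (x k) (y l) = 1"
  shows "dist (x k) (y k) = sqrt 2"
proof -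
  define d where "d k = x k - y k" for k
  define c where "c k = (1/2) *\<^sub>R (x k + y k)" for k
  have xc: "x k = c k + (1/2) *\<^sub>R d k" "y k = c k - (1/2) *\<^sub>R d k" for k
    by (auto simp: c_def d_def algebra_simps simp flip: scaleR_add_left)
  \<comment> \<open>Both \<open>x l\<close> and \<open>y l\<close> are equidistant from
    \<open>x k\<close> and \<open>y k\<close>, so they lie on the hyperplane bisecting that
    diagonal.\<close>
  have *: "(c l - c k) \<bullet> d k = 0 \<and> d l \<bullet> d k = 0" if "k \<noteq> l" for k l
  proof -
    have e: "norm (v + (1/2) *\<^sub>R d k) = 1 \<Longrightarrow> norm (v - (1/2) *\<^sub>R d k) = 1 \<Longrightarrow> v \<bullet> d k = 0" for v
      using norm_add_diff_orthogonal[of v "(1/2) *\<^sub>R d k"] by simp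
    have "(x l - c k) \<bullet> d k = 0"
      using xx[OF that[symmetric]] xy[OF that[symmetric]] 
      by (intro e) (simp_all add: dist_norm xc(1)[of k] xc(2)[of k] algebra_simps)
    moreover have "(y l - c k) \<bullet> d k = 0"
      using yy[OF that[symmetric]] xy[OF that] 
      by (intro e) (simp_all add: dist_norm xc(1)[of k] xc(2)[of k] algebra_simps norm_minus_commute)
    ultimately show ?thesis
      by (simp add: xc(1)[of l] xc(2)[of l] inner_diff_left inner_add_left)
  qed
  have nzd: "d k \<noteq> 0" for k using nz by (simp add: d_def)
  \<comment> \<open>All midpoints coincide: for a third index \<open>j\<close>, both
    \<open>c l - c j\<close> and \<open>c k - c j\<close> are orthogonal to
    \<open>d j\<close>.\<close>
  have cc: "c l = c k" for k l
  proof (cases "k = l")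
    case False
    have "c l - c k = 0"
    proof (rule orthogonal_to_orthogonal_family[where Y = d])
      show "(c l - c k) \<bullet> d j = 0" for j
      proof (cases "j = k \<or> j = l")
        case True
        then show ?thesis
          using *[of k l] *[of l k] False by (auto simp: inner_diff_left)
      next
        case False
        then have "(c l - c j) \<bullet> d j = 0" "(c k - c j) \<bullet> d j = 0"
          using *[of j l] *[of j k] by auto
        then show ?thesis by (simp add: inner_diff_left)
      qed
    qed (use nzd * in auto)
    then show ?thesis by simp
  qed simp
  have sum4: "d k \<bullet> d k + d l \<bullet> d l = 4" if "k \<noteq> l" for k l
  proof -
    have "x k - x l = (1/2) *\<^sub>R (d k - d l)"
      using cc[of k l] by (simp add: xc(1) algebra_simps)
    then have "((1/2) *\<^sub>R (d k - d l)) \<bullet> ((1/2) *\<^sub>R (d k - d l)) = 1"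
      using xx[OF that] by (simp add: dist_eq_1_iff)
    then show ?thesis
      using *[OF that] by (simp add: inner_diff_left inner_diff_right inner_commute)
  qed
  obtain l where l: "l \<noteq> k"
  proof -
    have "card (UNIV - {k}) \<ge> 1" using card by (simp add: card_Diff_subset)
    then have "UNIV - {k} \<noteq> {}" by (metis card.empty not_one_le_zero)
    then show ?thesis using that by auto
  qed
  obtain j where j: "j \<noteq> k" "j \<noteq> l"
  proof -
    have "card (UNIV - {k, l}) \<ge> 1" using card l by (simp add: card_Diff_subset)
    then have "UNIV - {k, l} \<noteq> {}" by (metis card.empty not_one_le_zero)
    then show ?thesis using that by auto
  qed
  have "d k \<bullet> d k = 2" using sum4[of k l] sum4[of k j] sum4[of l j] l j by auto
  then show ?thesis by (simp add: dist_norm d_def norm_eq_sqrt_inner)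
qed

text \<open>The vector \<open>z = c - a - b\<close> is orthogonal to \<open>n\<close> orthogonal directions: \<open>a - b\<close>, \<open>c\<close>
  and the normals \<open>E k\<close> of the plane.\<close>

lemma planar_rhombus:
  fixes a b c :: "real ^ 'n" and E :: "'n \<Rightarrow> real ^ 'n"
  assumes ij: "i \<noteq> j" and ab: "a \<noteq> b" and c0: "c \<noteq> 0"
    and nrm: "norm a = 1" "norm b = 1" "norm (c - a) = 1" "norm (c - b) = 1"
    and E0: "\<And>k. k \<notin> {i, j} \<Longrightarrow> E k \<noteq> 0"
    and EE: "\<And>k l. k \<notin> {i, j} \<Longrightarrow> l \<notin> {i, j} \<Longrightarrow> k \<noteq> l \<Longrightarrow> E k \<bullet> E l = 0"
    and aE: "\<And>k. k \<notin> {i, j} \<Longrightarrow> a \<bullet> E k = 0" and bE: "\<And>k. k \<notin> {i, j} \<Longrightarrow> b \<bullet> E k = 0"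
    and cE: "\<And>k. k \<notin> {i, j} \<Longrightarrow> c \<bullet> E k = 0"
  shows "c = a + b"
proof -
  have i: "a \<bullet> a = 1" "b \<bullet> b = 1" "c \<bullet> c = 2 * (c \<bullet> a)" "c \<bullet> c = 2 * (c \<bullet> b)"
    using nrm unfolding norm_eq_1
    by (simp_all add: inner_diff_left inner_diff_right inner_commute)
  define Y where "Y = E(i := a - b, j := c)"
  have "c - (a + b) = 0"
  proof (rule orthogonal_to_orthogonal_family[where Y = Y])
    show "Y k \<noteq> 0" for k using E0 ab c0 by (auto simp: Y_def)
    show "Y k \<bullet> Y l = 0" if "k \<noteq> l" for k l
      using that ij EE[of k l] aE bE cE i
      by (auto simp: Y_def inner_diff_left inner_diff_right inner_commute)
    show "(c - (a + b)) \<bullet> Y k = 0" for k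
      using ij aE bE cE i
      by (auto simp: Y_def inner_diff_left inner_diff_right inner_add_left inner_commute)
  qed
  then show ?thesis by simp
qed

text \<open>The six distances fix the inner products of \<open>p\<close>, \<open>q\<close>,
  \<open>r\<close>, and with them the norm of \<open>r - p - q\<close>, which is 0. Folding out of
  the plane is thus excluded in any dimension.\<close>

lemma square_rigid:
  fixes a b c d :: "'a::real_inner"
  assumes "dist a b = 1" "dist b c = 1" "dist c d = 1" "dist d a = 1"
    "dist a c = sqrt 2" "dist b d = sqrt 2"
  shows "d - a = c - b" and "(b - a) \<bullet> (d - a) = 0"
proof -
  define p q r where "p = b - a" and "q = d - a" and "r = c - a"
  have "norm p = 1" "norm q = 1" "norm r = sqrt 2" "norm (r - p) = 1" "norm (r - q) = 1"
    "norm (p - q) = sqrt 2"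
    using assms by (simp_all add: p_def q_def r_def dist_norm norm_minus_commute)
  then have sq: "p \<bullet> p = 1" "q \<bullet> q = 1" "r \<bullet> r = 2" "(r - p) \<bullet> (r - p) = 1"
    "(r - q) \<bullet> (r - q) = 1" "(p - q) \<bullet> (p - q) = 2"
    by (simp_all add: dot_square_norm)
  then have i: "p \<bullet> q = 0" "r \<bullet> p = 1" "r \<bullet> q = 1"
    by (auto simp: inner_diff_left inner_diff_right inner_commute)
  show "(b - a) \<bullet> (d - a) = 0" using i by (simp add: p_def q_def)
  have "(r - p - q) \<bullet> (r - p - q) = 0"
    using sq(1-3) i by (simp add: inner_diff_left inner_diff_right inner_commute)
  then have "r - p - q = 0" by simp
  then show "d - a = c - b" by (simp add: p_def q_def r_def algebra_simps)
qed

lemma eventually_finite_imp: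
  fixes P :: "'a::finite \<Rightarrow> 'b \<Rightarrow> bool"
  assumes "\<And>k. Q k \<Longrightarrow> eventually (P k) G"
  shows "eventually (\<lambda>f. \<forall>k. Q k \<longrightarrow> P k f) G"
  by (rule eventually_all_finite) (use assms in \<open>auto simp: eventually_const_iff\<close>)

lemma eventually_finite_imp2:
  fixes P :: "'a::finite \<Rightarrow> 'b::finite \<Rightarrow> 'c \<Rightarrow> bool"
  assumes "\<And>k l. Q k l \<Longrightarrow> eventually (P k l) G"
  shows "eventually (\<lambda>f. \<forall>k l. Q k l \<longrightarrow> P k l f) G"
  by (intro eventually_all_finite eventually_finite_imp assms)

text \<open>Removes the translation part of \<open>f\<close>, so that forced parallelogram laws
  become additivity.\<close>

definition phi :: "('a::real_vector \<Rightarrow> 'b::real_vector) \<Rightarrow> 'a \<Rightarrow> 'b" where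
  "phi f v = f v - f 0"

lemma phi_0 [simp]: "phi f 0 = 0"
  by (simp add: phi_def)

subsection \<open>Points over a field closed under square roots\<close>

text \<open>One argument serves both halves of the theorem: \<open>F\<close> will be all of the
  reals or the constructible numbers.\<close>

locale sqrt_closed_points =
  fixes F :: "real set" and W :: "(real ^ 'n) set"
  assumes card: "CARD('n) \<ge> 2"
    and W_eq: "W = {P. \<forall>i. P $ i \<in> F}"
    and F_0 [simp]: "0 \<in> F" and F_1 [simp]: "1 \<in> F"
    and F_add: "x \<in> F \<Longrightarrow> y \<in> F \<Longrightarrow> x + y \<in> F"
    and F_minus: "x \<in> F \<Longrightarrow> - x \<in> F"
    and F_mult: "x \<in> F \<Longrightarrow> y \<in> F \<Longrightarrow> x * y \<in> F"
    and F_inverse: "x \<in> F \<Longrightarrow> x \<noteq> 0 \<Longrightarrow> inverse x \<in> F"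
    and F_sqrt: "x \<in> F \<Longrightarrow> 0 \<le> x \<Longrightarrow> sqrt x \<in> F"
begin

lemma F_diff: "x \<in> F \<Longrightarrow> y \<in> F \<Longrightarrow> x - y \<in> F"
  using F_add[of x "- y"] F_minus by auto

lemma F_divide: "x \<in> F \<Longrightarrow> y \<in> F \<Longrightarrow> x / y \<in> F"
  by (cases "y = 0") (auto simp: divide_inverse intro: F_mult F_inverse)

lemma F_of_nat [simp]: "real k \<in> F"
  by (induction k) (auto intro: F_add)

lemma F_numeral [simp]: "numeral k \<in> F"
  using F_of_nat[of "numeral k"] by simp

lemma F_power: "x \<in> F \<Longrightarrow> x ^ k \<in> F"
  by (induction k) (auto intro: F_mult)

lemma F_sum: "(\<And>i. i \<in> A \<Longrightarrow> g i \<in> F) \<Longrightarrow> sum g A \<in> F"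
  by (induction A rule: infinite_finite_induct) (auto intro: F_add)

lemma W_0 [simp]: "0 \<in> W"
  and W_add: "x \<in> W \<Longrightarrow> y \<in> W \<Longrightarrow> x + y \<in> W"
  and W_diff: "x \<in> W \<Longrightarrow> y \<in> W \<Longrightarrow> x - y \<in> W"
  and W_minus: "x \<in> W \<Longrightarrow> - x \<in> W"
  and W_scaleR: "a \<in> F \<Longrightarrow> x \<in> W \<Longrightarrow> a *\<^sub>R x \<in> W"
  and W_axis: "axis i 1 \<in> W"
  by (auto simp: W_eq axis_def intro: F_add F_diff F_minus F_mult)

lemma F_inner: "x \<in> W \<Longrightarrow> y \<in> W \<Longrightarrow> x \<bullet> y \<in> F"
  by (auto simp: W_eq inner_vec_def intro: F_sum F_mult)

lemma F_norm: "x \<in> W \<Longrightarrow> norm x \<in> F"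
  by (simp add: norm_eq_sqrt_inner F_sqrt F_inner)

lemmas F_intros = F_add F_minus F_diff F_mult F_divide F_inverse F_sqrt F_power F_inner F_norm
lemmas W_intros = W_add W_minus W_diff W_scaleR W_axis F_intros

lemma W_householder: "c \<in> W \<Longrightarrow> x \<in> W \<Longrightarrow> householder c x \<in> W"
  by (auto simp: householder_def intro!: W_intros)

lemma ex_distinct_indices: "\<exists>i j :: 'n. i \<noteq> j"
proof (rule ccontr)
  assume "\<not> ?thesis"
  then have "UNIV = {undefined :: 'n}" by auto
  then have "CARD('n) = 1" by (metis card_1_singleton_iff One_nat_def)
  then show False using card by simp
qed

lemma ex_orthonormal_pair:
  assumes "u \<in> W"
  obtains e v where "e \<in> W" "v \<in> W" "norm e = 1" "norm v = 1" "e \<bullet> v = 0" "u = norm u *\<^sub>R e"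
proof -
  obtain i j :: 'n where ij: "i \<noteq> j"
    using ex_distinct_indices by blast
  show ?thesis
  proof (cases "u = 0")
    case True
    show ?thesis
      by (rule that[of "axis i 1" "axis j 1"]) (use True ij in \<open>auto simp: W_axis inner_axis_axis\<close>)
  next
    case False
    then obtain k where k: "u $ k \<noteq> 0" by (auto simp: vec_eq_iff)
    obtain l where l: "l \<noteq> k" using ij by metis
    \<comment> \<open>A quarter turn of the projection of \<open>u\<close> to the coordinate plane
      of \<open>k\<close> and \<open>l\<close>.\<close>
    define w where "w = u $ l *\<^sub>R axis k 1 - u $ k *\<^sub>R axis l (1::real)"
    have "w $ l = - (u $ k)" using l by (simp add: w_def axis_def)
    then have w0: "w \<noteq> 0" using k by auto
    have "u \<bullet> w = 0" by (simp add: w_def inner_diff_right inner_axis)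
    moreover have "w \<in> W" using assms by (auto simp: w_def W_eq intro!: W_intros)
      (auto simp: axis_def intro!: F_intros)
    ultimately show ?thesis
      using False w0 assms
      by (intro that[of "(1 / norm u) *\<^sub>R u" "(1 / norm w) *\<^sub>R w"]) (auto intro!: W_intros)
  qed
qed

text \<open>The reflection by \<open>c2\<close> fixes \<open>axis i 1\<close> and places the
  \<open>j\<close>-th axis so that the reflection by \<open>c1\<close>, which sends
  \<open>axis i 1\<close> to \<open>u\<close>, sends it to \<open>v\<close>.\<close>

lemma ex_frame:
  assumes u: "u \<in> W" "norm u = 1" and v: "v \<in> W" "norm v = 1" and uv: "u \<bullet> v = 0" and ij: "i \<noteq> j"
  obtains B :: "'n \<Rightarrow> real ^ 'n" where "B i = u" "B j = v" "\<And>k. B k \<in> W"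
    "\<And>k. B k \<bullet> B k = 1" "\<And>k l. k \<noteq> l \<Longrightarrow> B k \<bullet> B l = 0"
proof -
  define c1 where "c1 = axis i 1 - u"
  have h1: "householder c1 (axis i 1) = u" unfolding c1_def by (rule householder_diff) (simp add: u)
  then have h1': "householder c1 u = axis i 1" by (metis householder_involution)
  define v1 where "v1 = householder c1 v"
  have "v1 \<bullet> axis i 1 = v \<bullet> u" unfolding v1_def h1'[symmetric] by (rule householder_inner)
  then have v1i: "v1 \<bullet> axis i 1 = 0" using uv by (simp add: inner_commute)
  have nv1: "norm v1 = 1" using v by (simp add: v1_def norm_eq_sqrt_inner householder_inner)
  define c2 where "c2 = axis j 1 - v1"
  have h2: "householder c2 (axis j 1) = v1" unfolding c2_def by (rule householder_diff) (simp add: nv1)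
  have h2i: "householder c2 (axis i 1) = axis i 1"
    by (rule householder_orthogonal) (use ij v1i in \<open>simp add: c2_def inner_diff_left inner_axis_axis\<close>)
  have c: "c1 \<in> W" "v1 \<in> W" "c2 \<in> W"
    using u v by (auto simp: c1_def v1_def c2_def intro!: W_intros W_householder)
  show ?thesis
    by (rule that[of "\<lambda>k. householder c1 (householder c2 (axis k 1))"])
      (use c in \<open>auto simp: h1 h2 h2i v1_def householder_involution householder_inner
        inner_axis_axis intro!: W_intros W_householder\<close>)
qed

text \<open>The law of cosines gives the foot \<open>x\<close> of the altitude and a square root its
  height \<open>y\<close>, so \<open>z\<close> stays in \<open>W\<close>. The squared height factors
  as in Heron's formula; the triangle inequalities make it nonnegative.\<close>

lemma ex_triangle:
  assumes v: "v \<in> W" "v \<noteq> 0" and ab: "a \<in> F" "b \<in> F" "0 \<le> a" "0 \<le> b"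
    and tri: "\<bar>a - b\<bar> \<le> norm v" "norm v \<le> a + b"
  obtains z where "z \<in> W" "norm z = a" "norm (v - z) = b"
proof -
  obtain e w where e: "e \<in> W" "w \<in> W" "norm e = 1" "norm w = 1" "e \<bullet> w = 0" "v = norm v *\<^sub>R e"
    using ex_orthonormal_pair[OF v(1)] .
  define l where "l = norm v"
  have l: "l > 0" "l \<in> F" using v by (auto simp: l_def intro: F_intros)
  have ee: "e \<bullet> e = 1" "w \<bullet> w = 1" "w \<bullet> e = 0" using e by (auto simp: norm_eq_1 inner_commute)
  define x where "x = (a\<^sup>2 + l\<^sup>2 - b\<^sup>2) / (2 * l)"
  have x: "2 * l * x = a\<^sup>2 + l\<^sup>2 - b\<^sup>2" using l by (simp add: x_def)
  have "(a - b)\<^sup>2 \<le> l\<^sup>2" using tri l by (simp add: l_def abs_le_square_iff[symmetric])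
  moreover have "l\<^sup>2 \<le> (a + b)\<^sup>2" using tri l by (simp add: l_def)
  ultimately have *: "0 \<le> (l\<^sup>2 - (a - b)\<^sup>2) * ((a + b)\<^sup>2 - l\<^sup>2)" by simp
  have "(2 * l)\<^sup>2 * (a\<^sup>2 - x\<^sup>2) = (2 * l * a)\<^sup>2 - (2 * l * x)\<^sup>2"
    by (simp add: power_mult_distrib algebra_simps)
  also have "\<dots> = (l\<^sup>2 - (a - b)\<^sup>2) * ((a + b)\<^sup>2 - l\<^sup>2)"
    unfolding x by (simp add: power2_eq_square algebra_simps)
  finally have "0 \<le> (2 * l)\<^sup>2 * (a\<^sup>2 - x\<^sup>2)" using * by simp
  moreover have "(2 * l)\<^sup>2 > 0" using l by simp
  ultimately have y0: "a\<^sup>2 - x\<^sup>2 \<ge> 0" by (metis zero_le_mult_iff not_less)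
  define y where "y = sqrt (a\<^sup>2 - x\<^sup>2)"
  have y: "y\<^sup>2 = a\<^sup>2 - x\<^sup>2" using y0 by (simp add: y_def)
  have F: "x \<in> F" "y \<in> F" using ab l y0 by (auto simp: x_def y_def intro!: F_intros)
  define z where "z = x *\<^sub>R e + y *\<^sub>R w"
  have "z \<bullet> z = x\<^sup>2 + y\<^sup>2"
    using ee e(5) by (simp add: z_def inner_add_left inner_add_right power2_eq_square)
  then have "norm z = a" using y ab by (simp add: norm_eq_sqrt_inner)
  moreover have "v - z = (l - x) *\<^sub>R e - y *\<^sub>R w"
    by (subst e(6)) (simp add: z_def l_def algebra_simps)
  then have "(v - z) \<bullet> (v - z) = (l - x)\<^sup>2 + y\<^sup>2"
    using ee e(5) by (simp add: inner_diff_left inner_diff_right power2_eq_square)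
  then have "(v - z) \<bullet> (v - z) = b\<^sup>2" using y x by (simp add: power2_diff)
  then have "norm (v - z) = b" using ab by (simp add: norm_eq_sqrt_inner)
  moreover have "z \<in> W" using e F by (auto simp: z_def intro!: W_intros)
  ultimately show ?thesis by (rule that[rotated])
qed

text \<open>
  \<open>eventually P U\<close> says that \<open>P\<close> is forced by the unit distances within a finite subset of \<open>W\<close>.
\<close>

definition U :: "((real ^ 'n) \<Rightarrow> (real ^ 'n)) filter" where
  "U = (INF p\<in>{(u, v). u \<in> W \<and> v \<in> W \<and> dist u v = 1}.
      principal {f. dist (f (fst p)) (f (snd p)) = 1})"

lemma eventually_U_unit:
  assumes "u \<in> W" "v \<in> W" "dist u v = 1"
  shows "\<forall>\<^sub>F f in U. dist (f u) (f v) = 1"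
proof -
  have "U \<le> principal {f. dist (f u) (f v) = 1}"
    unfolding U_def using assms by (intro INF_lower2[of "(u, v)"]) auto
  then show ?thesis by (simp add: le_principal)
qed

text \<open>What holds eventually in an infimum of principal filters follows from finitely many of
  them; the endpoints of these unit pairs make up \<open>C\<close>.\<close>

lemma eventually_U_finite:
  assumes "eventually P U"
  obtains C where "finite C" "C \<subseteq> W" "\<And>f. preserves_unit_distance_on C f \<Longrightarrow> P f"
proof -
  define I where "I = {(u, v). u \<in> W \<and> v \<in> W \<and> dist u v = 1}"
  have "\<exists>X\<subseteq>I. finite X \<and> eventually P (INF p\<in>X. principal {f. dist (f (fst p)) (f (snd p)) = 1})"
    using assms unfolding U_def I_def[symmetric] by (rule eventually_INF[THEN iffD1])
  then obtain X where X: "X \<subseteq> {(u, v). u \<in> W \<and> v \<in> W \<and> dist u v = 1}" "finite X"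
    "eventually P (INF p\<in>X. principal {f. dist (f (fst p)) (f (snd p)) = 1})"
    unfolding I_def by blast
  define C where "C = fst ` X \<union> snd ` X"
  show ?thesis
  proof (rule that[of C])
    show "finite C" using X by (simp add: C_def)
    show "C \<subseteq> W" using X(1) by (auto simp: C_def)
    fix f assume f: "preserves_unit_distance_on C f"
    have "f \<in> (\<Inter>p\<in>X. {f. dist (f (fst p)) (f (snd p)) = 1})"
    proof
      fix p assume p: "p \<in> X"
      then have "fst p \<in> C" "snd p \<in> C" "dist (fst p) (snd p) = 1"
        using X(1) by (auto simp: C_def)
      then show "f \<in> {f. dist (f (fst p)) (f (snd p)) = 1}"
        using f by (simp add: preserves_unit_distance_on_def)
    qed
    then show "P f" using X(3) X(2) by (simp add: INF_principal_finite eventually_principal)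
  qed
qed

subsection \<open>Rigid distances and squares\<close>

lemma U_unit:
  assumes "x \<in> W" "u \<in> W" "norm u = 1"
  shows "\<forall>\<^sub>F f in U. norm (f (x + u) - f x) = 1"
  using eventually_U_unit[of "x + u" x] assms by (simp add: W_add dist_norm)

text \<open>Distance between the two apexes when regular unit simplices are glued along a
  facet.\<close>

definition lam :: real where "lam = sqrt (2 + 2 / real CARD('n))"

lemma lam: "lam \<in> F" "1 < lam" "lam \<le> 7 / 4" "lam\<^sup>2 = 2 + 2 / real CARD('n)"
proof -
  show "lam \<in> F" by (auto simp: lam_def intro!: F_intros)
  show "1 < lam" by (simp add: lam_def add_pos_nonneg)
  show "lam\<^sup>2 = 2 + 2 / real CARD('n)" by (simp add: lam_def)
  moreover have "2 / real CARD('n) \<le> 1" using card by simp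
  ultimately have "lam\<^sup>2 \<le> 3" by linarith
  then have "lam\<^sup>2 \<le> (7 / 4)\<^sup>2" by (simp add: power_divide)
  then show "lam \<le> 7 / 4" by (rule power2_le_imp_le) simp
qed

text \<open>\<open>P\<close> and \<open>Q\<close> become apexes over a common facet. The model facet
  is the rescaled standard basis, centred at 0 and orthogonal to the all-ones direction
  \<open>g\<close>; a reflection taking \<open>g\<close> to the direction of \<open>P - Q\<close>
  moves it into place. The images of the apexes may still coincide.\<close>

lemma eventually_dist_lam_or_eq:
  assumes PQ: "P \<in> W" "Q \<in> W" "dist P Q = lam"
  shows "\<forall>\<^sub>F f in U. f P = f Q \<or> dist (f P) (f Q) = lam"
proof -
  define n where "n = real CARD('n)"
  have n: "n \<ge> 2" using card by (simp add: n_def)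
  define v :: "real ^ 'n" where "v = (\<chi> i. 1)"
  have vv: "v \<bullet> v = n" by (simp add: v_def n_def inner_vec_def)
  have av: "v \<bullet> axis i 1 = 1" "axis i 1 \<bullet> v = 1" for i
    by (simp_all add: v_def inner_axis inner_axis')
  define g where "g = (1 / sqrt n) *\<^sub>R v"
  define d where "d = (1 / lam) *\<^sub>R (P - Q)"
  define M where "M = (1 / 2) *\<^sub>R (P + Q)"
  define s where "s i = (1 / sqrt 2) *\<^sub>R (axis i 1 - (1 / n) *\<^sub>R v)" for i
  define h where "h = householder (g - d)"
  have W: "v \<in> W" "g \<in> W" "d \<in> W" "M \<in> W" "s i \<in> W" for i
  proof -
    show v: "v \<in> W" by (simp add: v_def W_eq)
    have "n \<in> F" by (simp add: n_def)
    then show "g \<in> W" "d \<in> W" "M \<in> W" "s i \<in> W"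
      using v PQ lam n by (auto simp: g_def d_def M_def s_def intro!: W_intros)
  qed
  have gg: "g \<bullet> g = 1" using vv n by (simp add: g_def)
  then have "norm g = norm d" using PQ lam by (simp add: d_def dist_norm norm_eq_sqrt_inner[of g])
  then have hg: "h g = d" unfolding h_def by (rule householder_diff)
  have P: "P = M + h ((lam / 2) *\<^sub>R g)" and Q: "Q = M + h ((- lam / 2) *\<^sub>R g)"
  proof -
    have ha: "h (a *\<^sub>R g) = a *\<^sub>R d" for a using hg by (simp add: h_def householder_linear)
    have ld: "(lam / 2) *\<^sub>R d = (1 / 2) *\<^sub>R (P - Q)" "(- lam / 2) *\<^sub>R d = - (1 / 2) *\<^sub>R (P - Q)"
      using lam by (simp_all add: d_def)
    show "P = M + h ((lam / 2) *\<^sub>R g)" "Q = M + h ((- lam / 2) *\<^sub>R g)"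
      unfolding ha ld M_def by (simp_all add: algebra_simps flip: scaleR_add_left)
  qed
  define S where "S i = M + h (s i)" for i
  have SW: "S i \<in> W" for i using W by (auto simp: S_def h_def intro!: W_intros W_householder)
  have hd: "dist (h x) (h y) = norm (x - y)" for x y
    by (simp add: dist_norm norm_eq_sqrt_inner h_def householder_inner flip: householder_linear)
  have sg: "s i \<bullet> g = 0" "g \<bullet> s i = 0" for i
    using n by (simp_all add: s_def g_def inner_diff_left inner_diff_right av vv)
  have ss: "s i \<bullet> s i = (1 - 1 / n) / 2" for i
    using n by (simp add: s_def inner_diff_left inner_diff_right av vv inner_axis_axis)
  have PS: "dist (M + h (a *\<^sub>R g)) (S i) = 1" if "a\<^sup>2 = (1 + 1 / n) / 2" for a i
  proof -
    have "(a *\<^sub>R g - s i) \<bullet> (a *\<^sub>R g - s i) = 1"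
      using that by (simp add: inner_diff_left inner_diff_right gg sg ss power2_eq_square field_simps)
    then show ?thesis by (simp add: S_def hd norm_eq_1)
  qed
  have l2: "(lam / 2)\<^sup>2 = (1 + 1 / n) / 2" "(- lam / 2)\<^sup>2 = (1 + 1 / n) / 2"
    using lam(4) by (simp_all add: power_divide n_def)
  have SS: "dist (S i) (S j) = 1" if "i \<noteq> j" for i j
  proof -
    have "s i - s j = (1 / sqrt 2) *\<^sub>R (axis i 1 - axis j 1)" by (simp add: s_def algebra_simps)
    then have "(s i - s j) \<bullet> (s i - s j) = 1"
      using that by (simp add: inner_diff_left inner_diff_right inner_axis_axis)
    then show ?thesis by (simp add: S_def hd norm_eq_1)
  qed
  have "\<forall>\<^sub>F f in U. \<forall>i. dist (f P) (f (S i)) = 1"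
    using PS[OF l2(1)] P PQ SW by (intro eventually_all_finite eventually_U_unit) auto
  moreover have "\<forall>\<^sub>F f in U. \<forall>i. dist (f Q) (f (S i)) = 1"
    using PS[OF l2(2)] Q PQ SW by (intro eventually_all_finite eventually_U_unit) auto
  moreover have "\<forall>\<^sub>F f in U. \<forall>i j. i \<noteq> j \<longrightarrow> dist (f (S i)) (f (S j)) = 1"
    using SS SW
    by (intro eventually_finite_imp2 eventually_U_unit) auto
  ultimately show ?thesis
  proof eventually_elim
    case (elim f)
    then show ?case
      unfolding lam_def by (intro simplex_apex_dist[where \<sigma> = "\<lambda>i. f (S i)"]) auto
  qed
qed

text \<open>In a triangle with sides \<open>lam\<close>, \<open>lam\<close>, 1, collapsing
  \<open>P\<close> and \<open>Q\<close> would give the second long side an image of length 1, which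
  is neither 0 nor \<open>lam\<close>.\<close>

lemma eventually_dist_lam:
  assumes PQ: "P \<in> W" "Q \<in> W" "dist P Q = lam"
  shows "\<forall>\<^sub>F f in U. dist (f P) (f Q) = lam"
proof -
  have v: "norm (Q - P) = lam" using PQ by (simp add: dist_norm norm_minus_commute)
  obtain z where z: "z \<in> W" "norm z = lam" "norm (Q - P - z) = 1"
    by (rule ex_triangle[of "Q - P" lam 1]) (use v PQ lam in \<open>auto intro!: W_intros\<close>)
  have R: "P + z \<in> W" "dist P (P + z) = lam" "dist Q (P + z) = 1"
    using z PQ by (auto simp: dist_norm norm_minus_commute algebra_simps intro: W_intros)
  from eventually_dist_lam_or_eq[OF PQ] eventually_dist_lam_or_eq[OF PQ(1) R(1,2)]
    eventually_U_unit[OF PQ(2) R(1,3)]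
  show ?thesis
    by eventually_elim (use lam in auto)
qed

text \<open>All distances in \<open>[lam - 1, lam + 1]\<close> would do; the bounds 3/4 and 2 work for every \<open>n\<close>.\<close>

lemma eventually_neq:
  assumes xy: "x \<in> W" "y \<in> W" and "3 / 4 \<le> dist x y" "dist x y \<le> 2"
  shows "\<forall>\<^sub>F f in U. f x \<noteq> f y"
proof -
  have v: "norm (y - x) = dist x y" by (simp add: dist_norm norm_minus_commute)
  obtain z where z: "z \<in> W" "norm z = lam" "norm (y - x - z) = 1"
    by (rule ex_triangle[of "y - x" lam 1]) (use v assms lam in \<open>auto intro!: W_intros\<close>)
  have R: "x + z \<in> W" "dist x (x + z) = lam" "dist y (x + z) = 1"
    using z xy by (auto simp: dist_norm norm_minus_commute algebra_simps intro: W_intros)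
  from eventually_dist_lam[OF xy(1) R(1,2)] eventually_U_unit[OF xy(2) R(1,3)]
  show ?thesis
    by eventually_elim (use lam in auto)
qed

text \<open>The points \<open>M\<close> plus or minus \<open>B k / sqrt 2\<close> form a
  cross-polytope with unit edges and \<open>X\<close>, \<open>Y\<close> as opposite vertices. Its
  diagonals are in the range where images stay distinct.\<close>

lemma eventually_dist_sqrt2:
  assumes card3: "CARD('n) \<ge> 3" and XY: "X \<in> W" "Y \<in> W" "dist X Y = sqrt 2"
  shows "\<forall>\<^sub>F f in U. dist (f X) (f Y) = sqrt 2"
proof -
  have s2: "3 / 4 \<le> sqrt 2" "sqrt 2 \<le> 2"
    by (rule real_le_rsqrt, simp add: power2_eq_square) (rule real_le_lsqrt, simp_all)
  obtain i j :: 'n where ij: "i \<noteq> j" using ex_distinct_indices by blast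
  obtain e v where e: "e \<in> W" "v \<in> W" "norm e = 1" "norm v = 1" "e \<bullet> v = 0" "X - Y = norm (X - Y) *\<^sub>R e"
    using ex_orthonormal_pair[of "X - Y"] XY W_diff by metis
  obtain B where B: "B i = e" "B j = v" "\<And>k. B k \<in> W" "\<And>k. B k \<bullet> B k = 1"
    "\<And>k l. k \<noteq> l \<Longrightarrow> B k \<bullet> B l = 0"
    using ex_frame[OF e(1,3,2,4,5) ij] by metis
  define M where "M = (1 / 2) *\<^sub>R (X + Y)"
  define x y where "x k = M + (1 / sqrt 2) *\<^sub>R B k" and "y k = M - (1 / sqrt 2) *\<^sub>R B k" for k
  have W: "x k \<in> W" "y k \<in> W" for k
    using XY B(3)[of k] by (auto simp: x_def y_def M_def intro!: W_intros)
  have half: "(1 / sqrt 2) = sqrt 2 / 2" by (simp add: real_div_sqrt field_simps)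
  have "X - Y = sqrt 2 *\<^sub>R B i" using e(6) XY(3) B(1) by (simp add: dist_norm)
  then have h: "(1 / sqrt 2) *\<^sub>R B i = (1 / 2) *\<^sub>R (X - Y)" by (simp add: half)
  have X: "x i = X" and Y: "y i = Y"
    unfolding x_def y_def h M_def by (simp_all add: algebra_simps flip: scaleR_add_left)
  have d: "dist (x k) (x l) = 1" "dist (y k) (y l) = 1" "dist (x k) (y l) = 1" if "k \<noteq> l" for k l
    using that B(4)[of k] B(4)[of l] B(5)[of k l] B(5)[of l k]
    by (simp_all add: dist_eq_1_iff x_def y_def inner_add_left inner_add_right inner_diff_left
        inner_diff_right)
  have "x k - y k = sqrt 2 *\<^sub>R B k" for k
    by (simp add: x_def y_def half flip: scaleR_add_left)
  then have dk: "dist (x k) (y k) = sqrt 2" for k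
    using B(4)[of k] by (simp add: dist_norm norm_eq_1[THEN iffD2])
  have U: "\<forall>\<^sub>F f in U. \<forall>k l. k \<noteq> l \<longrightarrow> dist (f (p k)) (f (q l)) = 1"
    if "\<And>k. p k \<in> W" "\<And>k. q k \<in> W" "\<And>k l. k \<noteq> l \<Longrightarrow> dist (p k) (q l) = 1" for p q :: "'n \<Rightarrow> real ^ 'n"
    by (intro eventually_finite_imp2 eventually_U_unit that)
  have "\<forall>\<^sub>F f in U. \<forall>k. f (x k) \<noteq> f (y k)"
    using W dk s2 by (intro eventually_all_finite eventually_neq) auto
  moreover have "\<forall>\<^sub>F f in U. \<forall>k l. k \<noteq> l \<longrightarrow> dist (f (x k)) (f (x l)) = 1"
    by (rule U) (use W d in auto)
  moreover have "\<forall>\<^sub>F f in U. \<forall>k l. k \<noteq> l \<longrightarrow> dist (f (y k)) (f (y l)) = 1"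
    by (rule U) (use W d in auto)
  moreover have "\<forall>\<^sub>F f in U. \<forall>k l. k \<noteq> l \<longrightarrow> dist (f (x k)) (f (y l)) = 1"
    by (rule U) (use W d in auto)
  ultimately have "\<forall>\<^sub>F f in U. dist (f (x i)) (f (y i)) = sqrt 2"
  proof eventually_elim
    case (elim f)
    show ?case
      by (rule cross_polytope_diagonal[OF card3, of "\<lambda>k. f (x k)" "\<lambda>k. f (y k)"]) (use elim in auto)
  qed
  then show ?thesis by (simp add: X Y)
qed

lemma eventually_square:
  assumes card3: "CARD('n) \<ge> 3" and W: "A \<in> W" "x \<in> W" "e \<in> W"
    and xe: "norm x = 1" "norm e = 1" "x \<bullet> e = 0"
  shows "\<forall>\<^sub>F f in U. f (A + x + e) - f (A + x) = f (A + e) - f A \<and>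
    (f (A + x) - f A) \<bullet> (f (A + e) - f A) = 0"
proof -
  have W': "A + x \<in> W" "A + e \<in> W" "A + x + e \<in> W" using W by (auto intro!: W_intros)
  have "norm (x + e) = sqrt 2" "norm (x - e) = sqrt 2"
    using xe by (simp_all add: norm_eq_sqrt_inner inner_add_left inner_add_right inner_diff_left
        inner_diff_right inner_commute)
  then have "dist A (A + x + e) = sqrt 2" "dist (A + x) (A + e) = sqrt 2"
    by (simp_all add: dist_norm norm_minus_commute algebra_simps)
  note 1 = eventually_dist_sqrt2[OF card3 W(1) W'(3) this(1)]
    eventually_dist_sqrt2[OF card3 W'(1,2) this(2)]
  have 2: "\<forall>\<^sub>F f in U. dist (f A) (f (A + x)) = 1" "\<forall>\<^sub>F f in U. dist (f (A + x)) (f (A + x + e)) = 1"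
    "\<forall>\<^sub>F f in U. dist (f (A + x + e)) (f (A + e)) = 1" "\<forall>\<^sub>F f in U. dist (f (A + e)) (f A) = 1"
    by (rule eventually_U_unit; use W W' xe in \<open>simp add: dist_norm norm_minus_commute\<close>)+
  from 1 2 show ?thesis
  proof eventually_elim
    case (elim f)
    from square_rigid[of "f A" "f (A + x)" "f (A + x + e)" "f (A + e)"] elim show ?case by simp
  qed
qed

subsection \<open>Parallelograms\<close>

text \<open>The base point is quantified outside the filter: each \<open>A\<close> may use its own
  finite set of unit distances.\<close>

definition transl :: "real ^ 'n \<Rightarrow> real ^ 'n \<Rightarrow> bool" where
  "transl u w \<longleftrightarrow> (\<forall>A\<in>W. \<forall>\<^sub>F f in U. f (A + u + w) - f (A + w) = f (A + u) - f A)"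

text \<open>For \<open>n = 2\<close> no index lies outside \<open>{i, j}\<close>, so the families of
  normals below are empty and squares are invoked only for \<open>n \<ge> 3\<close>.\<close>

lemma card3:
  assumes "i \<noteq> j" "k \<notin> {i, j :: 'n}"
  shows "CARD('n) \<ge> 3"
proof -
  have "card {i, j, k} \<le> CARD('n)" by (rule card_mono) auto
  then show ?thesis using assms by auto
qed

text \<open>The \<open>B k\<close> with \<open>k\<close> outside \<open>{i, j}\<close> are normal to
  the rhombus. Squares over its sides make the image sides orthogonal to the image normals, the
  lower bounds keep the diagonals from collapsing, and \<open>planar_rhombus\<close> leaves only a
  parallelogram.\<close>

lemma transl_rhombus:
  assumes W: "u \<in> W" "w \<in> W" and n: "norm u = 1" "norm w = 1"
    and plus: "3 / 4 \<le> norm (u + w)" and minus: "3 / 4 \<le> norm (u - w)"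
  shows "transl u w"
  unfolding transl_def
proof
  fix A assume A: "A \<in> W"
  define t where "t = w \<bullet> u"
  define w' where "w' = w - t *\<^sub>R u"
  have uu: "u \<bullet> u = 1" "w \<bullet> w = 1" using n by (simp_all add: norm_eq_1)
  have "w' \<noteq> 0"
  proof
    assume "w' = 0"
    then have w: "w = t *\<^sub>R u" by (simp add: w'_def)
    then have "\<bar>t\<bar> = 1" using n by auto
    then have "t = 1 \<or> t = -1" by linarith
    then show False using w plus minus by auto
  qed
  define v where "v = (1 / norm w') *\<^sub>R w'"
  have tF: "t \<in> F" and w'W: "w' \<in> W" using W by (auto simp: t_def w'_def intro!: W_intros)
  then have v: "v \<in> W" "norm v = 1" "w = t *\<^sub>R u + norm w' *\<^sub>R v"
    using \<open>w' \<noteq> 0\<close> by (auto simp: v_def w'_def intro!: W_intros)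
  have "u \<bullet> w' = 0" using uu by (simp add: w'_def t_def inner_diff_right inner_commute)
  then have uv: "u \<bullet> v = 0" by (simp add: v_def)
  obtain i j :: 'n where ij: "i \<noteq> j" using ex_distinct_indices by blast
  obtain B where B: "B i = u" "B j = v" "\<And>k. B k \<in> W" "\<And>k. B k \<bullet> B k = 1"
    "\<And>k l. k \<noteq> l \<Longrightarrow> B k \<bullet> B l = 0"
    using ex_frame[OF W(1) n(1) v(1,2) uv ij] by metis
  have nB: "norm (B k) = 1" for k using B(4) by (simp add: norm_eq_1)
  have uB: "u \<bullet> B k = 0" and wB: "w \<bullet> B k = 0" if "k \<notin> {i, j}" for k
    using B(5)[of i k] B(5)[of j k] that by (auto simp: B(1,2) v(3) inner_add_left)
  have sides: "\<forall>\<^sub>F f in U. norm (f (A + u) - f A) = 1" "\<forall>\<^sub>F f in U. norm (f (A + w) - f A) = 1"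
    "\<forall>\<^sub>F f in U. norm (f (A + u + w) - f (A + u)) = 1"
    "\<forall>\<^sub>F f in U. norm (f (A + w + u) - f (A + w)) = 1"
    using A W n by (auto intro!: U_unit W_intros)
  have "norm (u + w) \<le> 2" "norm (u - w) \<le> 2"
    using norm_triangle_ineq[of u w] norm_triangle_ineq4[of u w] n by auto
  then have diag: "\<forall>\<^sub>F f in U. f (A + u + w) \<noteq> f A" "\<forall>\<^sub>F f in U. f (A + u) \<noteq> f (A + w)"
    using A W plus minus by (auto intro!: eventually_neq W_intros simp: dist_norm add.assoc)
  have sq: "\<forall>\<^sub>F f in U. \<forall>k. k \<notin> {i, j} \<longrightarrow> f (A' + x + B k) - f (A' + x) = f (A' + B k) - f A' \<and>
    (f (A' + x) - f A') \<bullet> (f (A' + B k) - f A') = 0"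
    if "A' \<in> W" "x \<in> W" "norm x = 1" "\<And>k. k \<notin> {i, j} \<Longrightarrow> x \<bullet> B k = 0" for A' x
    using that B(3) nB card3[OF ij] by (intro eventually_finite_imp eventually_square) auto
  have sq1: "\<forall>\<^sub>F f in U. \<forall>k. k \<notin> {i, j} \<longrightarrow> f (A + u + B k) - f (A + u) = f (A + B k) - f A \<and>
    (f (A + u) - f A) \<bullet> (f (A + B k) - f A) = 0"
    by (rule sq) (use A W n uB in auto)
  have sq2: "\<forall>\<^sub>F f in U. \<forall>k. k \<notin> {i, j} \<longrightarrow> f (A + w + B k) - f (A + w) = f (A + B k) - f A \<and>
    (f (A + w) - f A) \<bullet> (f (A + B k) - f A) = 0"
    by (rule sq) (use A W n wB in auto)
  \<comment> \<open>These squares start at \<open>A + u\<close>; \<open>sq1\<close> identifies the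
    image normals there with those at \<open>A\<close>, so the image diagonal is orthogonal to them
    as well.\<close>
  have sq3: "\<forall>\<^sub>F f in U. \<forall>k. k \<notin> {i, j} \<longrightarrow>
    f (A + u + w + B k) - f (A + u + w) = f (A + u + B k) - f (A + u) \<and>
    (f (A + u + w) - f (A + u)) \<bullet> (f (A + u + B k) - f (A + u)) = 0"
    by (rule sq) (use A W n wB in \<open>auto intro: W_intros\<close>)
  have EE: "\<forall>\<^sub>F f in U. \<forall>k l. k \<notin> {i, j} \<and> l \<notin> {i, j} \<and> k \<noteq> l \<longrightarrow>
    (f (A + B k) - f A) \<bullet> (f (A + B l) - f A) = 0"
  proof (rule eventually_finite_imp2)
    fix k l assume kl: "k \<notin> {i, j} \<and> l \<notin> {i, j} \<and> k \<noteq> l"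
    show "\<forall>\<^sub>F f in U. (f (A + B k) - f A) \<bullet> (f (A + B l) - f A) = 0"
      by (rule eventually_mono[OF eventually_square[of A "B k" "B l"]])
        (use card3[OF ij, of k] kl A B nB in auto)
  qed
  have En: "\<forall>\<^sub>F f in U. \<forall>k. norm (f (A + B k) - f A) = 1"
    using A B nB by (intro eventually_all_finite U_unit) auto
  from sides diag sq1 sq2 sq3 EE En
  show "\<forall>\<^sub>F f in U. f (A + u + w) - f (A + w) = f (A + u) - f A"
  proof eventually_elim
    case (elim f)
    have uE: "(f (A + u) - f A) \<bullet> (f (A + B k) - f A) = 0"
      and uE': "f (A + u + B k) - f (A + u) = f (A + B k) - f A"
      and wE: "(f (A + w) - f A) \<bullet> (f (A + B k) - f A) = 0"
      and uwE: "(f (A + u + w) - f (A + u)) \<bullet> (f (A + u + B k) - f (A + u)) = 0"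
      if "k \<notin> {i, j}" for k
      using elim(7)[rule_format, OF that] elim(8)[rule_format, OF that] elim(9)[rule_format, OF that]
      by blast+
    have "f (A + u + w) - f A = (f (A + u) - f A) + (f (A + w) - f A)"
    proof (rule planar_rhombus[where i = i and j = j and E = "\<lambda>k. f (A + B k) - f A"])
      show "f (A + B k) - f A \<noteq> 0" for k using elim(11) by (metis norm_zero zero_neq_one)
      show "(f (A + B k) - f A) \<bullet> (f (A + B l) - f A) = 0"
        if "k \<notin> {i, j}" "l \<notin> {i, j}" "k \<noteq> l" for k l
        using elim(10) that by blast
      show "(f (A + u + w) - f A) \<bullet> (f (A + B k) - f A) = 0" if "k \<notin> {i, j}" for k
        using uwE[OF that] uE[OF that] unfolding uE'[OF that] by (simp add: inner_diff_left)
      show "f (A + u) - f A \<noteq> f (A + w) - f A" "f (A + u + w) - f A \<noteq> 0"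
        using elim(5,6) by auto
      show "norm (f (A + u + w) - f A - (f (A + w) - f A)) = 1"
        using elim(4) by (simp add: add_ac)
    qed (use ij elim(1-3) uE wE in auto)
    then show ?case by (simp add: algebra_simps)
  qed
qed

lemma transl_commute: "transl u w \<Longrightarrow> transl w u"
  unfolding transl_def by (auto simp: algebra_simps elim!: ballE eventually_mono)

lemma transl_add:
  assumes "w \<in> W" "w' \<in> W" "transl u w" "transl u w'"
  shows "transl u (w + w')"
  unfolding transl_def
proof
  fix A assume "A \<in> W"
  then have "\<forall>\<^sub>F f in U. f (A + u + w) - f (A + w) = f (A + u) - f A"
    "\<forall>\<^sub>F f in U. f (A + w + u + w') - f (A + w + w') = f (A + w + u) - f (A + w)"
    using assms by (auto simp: transl_def intro: W_intros)
  then show "\<forall>\<^sub>F f in U. f (A + u + (w + w')) - f (A + (w + w')) = f (A + u) - f A"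
    by eventually_elim (simp add: add_ac)
qed

lemma transl_minus:
  assumes "w \<in> W" "transl u w"
  shows "transl u (- w)"
  unfolding transl_def
proof
  fix A assume "A \<in> W"
  then have "A - w \<in> W" using assms by (auto intro: W_intros)
  then have "\<forall>\<^sub>F f in U. f (A - w + u + w) - f (A - w + w) = f (A - w + u) - f (A - w)"
    using assms by (auto simp: transl_def)
  then show "\<forall>\<^sub>F f in U. f (A + u + - w) - f (A + - w) = f (A + u) - f A"
    by eventually_elim (simp add: algebra_simps)
qed

lemma transl_diff: "w \<in> W \<Longrightarrow> w' \<in> W \<Longrightarrow> transl u w \<Longrightarrow> transl u w' \<Longrightarrow> transl u (w - w')"
  using transl_add[of w "- w'"] transl_minus[of w'] W_minus by auto

lemma transl_0: "transl u 0"
  by (simp add: transl_def)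

lemma transl_of_nat: "w \<in> W \<Longrightarrow> transl u w \<Longrightarrow> transl u (real k *\<^sub>R w)"
proof (induction k)
  case (Suc k)
  then have "transl u (real k *\<^sub>R w + w)" by (intro transl_add) (auto intro: W_intros)
  then show ?case by (simp add: scaleR_left_distrib add.commute)
qed (simp add: transl_0)

lemma transl_scaleR_if_small:
  assumes "w \<in> W" and small: "\<And>c. c \<in> F \<Longrightarrow> 0 \<le> c \<Longrightarrow> c \<le> 1 / 4 \<Longrightarrow> transl u (c *\<^sub>R w)" and "c \<in> F"
  shows "transl u (c *\<^sub>R w)"
proof -
  obtain N :: nat where N: "4 * \<bar>c\<bar> < N" using reals_Archimedean2 by blast
  then have N0: "real N > 0" by (metis abs_ge_zero mult_nonneg_nonneg not_le order_trans zero_le_numeral less_le_trans nle_le)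
  have abs: "\<bar>c\<bar> \<in> F" using \<open>c \<in> F\<close> by (auto simp: abs_if F_minus)
  have "transl u ((\<bar>c\<bar> / N) *\<^sub>R w)"
    using N N0 abs by (intro small) (auto simp: divide_simps intro!: F_intros)
  then have "transl u (real N *\<^sub>R ((\<bar>c\<bar> / N) *\<^sub>R w))"
    using assms(1) abs by (intro transl_of_nat) (auto intro!: W_intros)
  then have "transl u (\<bar>c\<bar> *\<^sub>R w)" using N0 by simp
  then show ?thesis
    using transl_minus[of "\<bar>c\<bar> *\<^sub>R w" u] assms(1) abs by (auto simp: abs_if W_scaleR split: if_splits)
qed

text \<open>Rhombi are built on \<open>u\<close> and the unit vectors \<open>a v + b u\<close>,
  \<open>a v - b u\<close>. Differences of these two yield multiples of \<open>u\<close>, sums yield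
  multiples of \<open>v\<close>.\<close>

lemma transl_orthonormal:
  assumes W: "u \<in> W" "v \<in> W" and n: "norm u = 1" "norm v = 1" "u \<bullet> v = 0" and c: "c \<in> F"
  shows "transl u (c *\<^sub>R u)" "transl u (c *\<^sub>R v)"
proof -
  have uv: "u \<bullet> u = 1" "v \<bullet> v = 1" "u \<bullet> v = 0" "v \<bullet> u = 0"
    using n by (simp_all add: norm_eq_1 inner_commute)
  \<comment> \<open>The bound on \<open>b\<close> keeps both diagonals at length at least 1.\<close>
  have *: "transl u (a *\<^sub>R v + b *\<^sub>R u)" if ab: "a \<in> F" "b \<in> F" "a\<^sup>2 + b\<^sup>2 = 1" "\<bar>b\<bar> \<le> 1 / 2" for a b
  proof (rule transl_rhombus)
    let ?x = "a *\<^sub>R v + b *\<^sub>R u"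
    have xx: "?x \<bullet> ?x = 1" using uv ab(3)
      by (simp add: inner_add_left inner_add_right power2_eq_square)
    then show "norm ?x = 1" by (simp add: norm_eq_1)
    have ux: "u \<bullet> ?x = b" using uv by (simp add: inner_add_right)
    have "(u + ?x) \<bullet> (u + ?x) = 2 + 2 * b" "(u - ?x) \<bullet> (u - ?x) = 2 - 2 * b"
      using uv xx ux by (simp_all add: inner_add_left inner_add_right inner_diff_left inner_diff_right inner_commute)
    moreover have "1 \<le> 2 + 2 * b" "1 \<le> 2 - 2 * b" using ab(4) by linarith+
    ultimately have "norm (u + ?x) \<ge> 1" "norm (u - ?x) \<ge> 1"
      unfolding norm_eq_sqrt_inner by simp_all
    then show "3 / 4 \<le> norm (u + ?x)" "3 / 4 \<le> norm (u - ?x)" by linarith+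
  qed (use W n ab in \<open>auto intro!: W_intros\<close>)
  show "transl u (c *\<^sub>R u)"
  proof (rule transl_scaleR_if_small[OF W(1) _ c])
    fix c :: real assume c: "c \<in> F" "0 \<le> c" "c \<le> 1 / 4"
    define b a where "b = c / 2" and "a = sqrt (1 - b\<^sup>2)"
    have "b\<^sup>2 \<le> 1\<^sup>2" using c by (intro power_mono) (auto simp: b_def)
    then have a: "a\<^sup>2 = 1 - b\<^sup>2" by (simp add: a_def)
    have F: "a \<in> F" "b \<in> F" using c \<open>b\<^sup>2 \<le> 1\<^sup>2\<close> by (auto simp: a_def b_def intro!: F_intros)
    have "transl u ((a *\<^sub>R v + b *\<^sub>R u) - (a *\<^sub>R v + (- b) *\<^sub>R u))"
      using W F a c by (intro transl_diff * W_intros) (auto simp: b_def intro: F_intros)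
    moreover have "(a *\<^sub>R v + b *\<^sub>R u) - (a *\<^sub>R v + (- b) *\<^sub>R u) = c *\<^sub>R u"
      by (simp add: b_def flip: scaleR_add_left)
    ultimately show "transl u (c *\<^sub>R u)" by simp
  qed
  \<comment> \<open>From \<open>t \<ge> 7/4\<close> follows \<open>a \<ge> 7/8\<close>, hence
    \<open>b\<^sup>2 \<le> 15/64 < 1/4\<close>. Small multiples of \<open>v\<close> arise below as
    differences of two such vectors.\<close>
  have **: "transl u (t *\<^sub>R v)" if t: "t \<in> F" "7 / 4 \<le> t" "t \<le> 2" for t
  proof -
    define a b where "a = t / 2" and "b = sqrt (1 - a\<^sup>2)"
    have "a\<^sup>2 \<le> 1\<^sup>2" using t by (intro power_mono) (auto simp: a_def)
    then have b: "b\<^sup>2 = 1 - a\<^sup>2" "b \<ge> 0" by (simp_all add: b_def)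
    have F: "a \<in> F" "b \<in> F" using t \<open>a\<^sup>2 \<le> 1\<^sup>2\<close> by (auto simp: a_def b_def intro!: F_intros)
    have "(7 / 8)\<^sup>2 \<le> a\<^sup>2" using t by (intro power_mono) (auto simp: a_def)
    then have "b\<^sup>2 \<le> (1 / 2)\<^sup>2" using b by (simp add: power2_eq_square)
    then have "b \<le> 1 / 2" by (rule power2_le_imp_le) simp
    then have "transl u ((a *\<^sub>R v + b *\<^sub>R u) + (a *\<^sub>R v + (- b) *\<^sub>R u))"
      using W F b by (intro transl_add * W_intros) (auto intro: F_intros)
    moreover have "(a *\<^sub>R v + b *\<^sub>R u) + (a *\<^sub>R v + (- b) *\<^sub>R u) = (a + a) *\<^sub>R v"
      unfolding scaleR_add_left by simp
    moreover have "a + a = t" by (simp add: a_def)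
    ultimately show ?thesis by simp
  qed
  show "transl u (c *\<^sub>R v)"
  proof (rule transl_scaleR_if_small[OF W(2) _ c])
    fix c :: real assume c: "c \<in> F" "0 \<le> c" "c \<le> 1 / 4"
    have "transl u ((7 / 4 + c) *\<^sub>R v - (7 / 4) *\<^sub>R v)"
      using W c by (intro transl_diff ** W_intros) auto
    then show "transl u (c *\<^sub>R v)" by (simp flip: scaleR_diff_left)
  qed
qed

lemma transl_unit:
  assumes W: "u \<in> W" "w \<in> W" and n: "norm u = 1"
  shows "transl u w"
proof -
  define t w' where "t = w \<bullet> u" and "w' = w - t *\<^sub>R u"
  have tF: "t \<in> F" and w'W: "w' \<in> W" using W by (auto simp: t_def w'_def intro!: W_intros)
  obtain v where v: "v \<in> W" "norm v = 1" "u \<bullet> v = 0"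
    using ex_orthonormal_pair[OF W(1)] n by (metis scaleR_one)
  have 1: "transl u (t *\<^sub>R u)" by (rule transl_orthonormal(1)[OF W(1) v(1) n v(2,3) tF])
  have 2: "transl u w'"
  proof (cases "w' = 0")
    case False
    define e where "e = (1 / norm w') *\<^sub>R w'"
    have "u \<bullet> w' = 0" using n by (simp add: w'_def t_def inner_diff_right inner_commute norm_eq_1)
    then have "transl u (norm w' *\<^sub>R e)"
      using W(1) w'W n False by (intro transl_orthonormal(2)) (auto simp: e_def intro!: W_intros)
    then show ?thesis using False by (simp add: e_def)
  qed (simp add: transl_0)
  have "transl u (t *\<^sub>R u + w')"
    using 1 2 tF w'W W by (intro transl_add) (auto intro: W_intros)
  then show ?thesis by (simp add: w'_def)
qed

text \<open>Two unit vectors symmetric about \<open>p\<close> sum to a short multiple of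
  \<open>p\<close>, so facts about unit vectors reach all lengths. Their coordinates are recorded so
  that orthogonality to further vectors carries over.\<close>

lemma unit_sum:
  assumes pq: "p \<in> W" "q \<in> W" "norm p = 1" "norm q = 1" "p \<bullet> q = 0" and r: "r \<in> F"
  obtains N :: nat and x y a b where "r *\<^sub>R p = real N *\<^sub>R (x + y)" "x \<in> W" "y \<in> W" "norm x = 1" "norm y = 1"
    "x = a *\<^sub>R p + b *\<^sub>R q" "y = a *\<^sub>R p - b *\<^sub>R q"
proof -
  obtain N :: nat where N: "\<bar>r\<bar> < N" using reals_Archimedean2 by blast
  then have N0: "real N > 0" using abs_ge_zero[of r] by linarith
  define a b where "a = r / (2 * N)" and "b = sqrt (1 - a\<^sup>2)"
  have "\<bar>a\<bar> \<le> 1" using N N0 by (simp add: a_def abs_mult divide_simps)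
  then have a: "a\<^sup>2 \<le> 1" by (simp add: abs_square_le_1)
  then have b: "b\<^sup>2 = 1 - a\<^sup>2" by (simp add: b_def)
  have F: "a \<in> F" "b \<in> F" using r a by (auto simp: a_def b_def intro!: F_intros)
  have i: "p \<bullet> p = 1" "q \<bullet> q = 1" "q \<bullet> p = 0" "p \<bullet> q = 0" using pq by (simp_all add: norm_eq_1 inner_commute)
  show ?thesis
  proof (rule that[of N "a *\<^sub>R p + b *\<^sub>R q" "a *\<^sub>R p - b *\<^sub>R q" a b])
    show "r *\<^sub>R p = real N *\<^sub>R (a *\<^sub>R p + b *\<^sub>R q + (a *\<^sub>R p - b *\<^sub>R q))"
    proof -
      have "a *\<^sub>R p + b *\<^sub>R q + (a *\<^sub>R p - b *\<^sub>R q) = (a + a) *\<^sub>R p"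
        unfolding scaleR_add_left by simp
      moreover have "real N * (a + a) = r" using N0 by (simp add: a_def)
      ultimately show ?thesis by (metis scaleR_scaleR)
    qed
    show "norm (a *\<^sub>R p + b *\<^sub>R q) = 1" "norm (a *\<^sub>R p - b *\<^sub>R q) = 1"
      unfolding norm_eq_1 using i b
      by (simp_all add: inner_add_left inner_add_right inner_diff_left inner_diff_right power2_eq_square)
  qed (use pq F in \<open>auto intro: W_intros\<close>)
qed

lemma transl_all:
  assumes W: "u \<in> W" "w \<in> W"
  shows "transl u w"
proof -
  obtain p q where p: "p \<in> W" "q \<in> W" "norm p = 1" "norm q = 1" "p \<bullet> q = 0" "u = norm u *\<^sub>R p"
    using ex_orthonormal_pair[OF W(1)] .
  obtain N x y a b where *: "norm u *\<^sub>R p = real N *\<^sub>R (x + y)" "x \<in> W" "y \<in> W" "norm x = 1" "norm y = 1"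
    using unit_sum[OF p(1-5) F_norm[OF W(1)]] by metis
  have "transl w x" "transl w y" using * W transl_unit transl_commute by blast+
  then have "transl w (real N *\<^sub>R (x + y))" using * by (intro transl_of_nat transl_add W_intros)
  then show ?thesis using p(6) *(1) transl_commute by metis
qed

section \<open>Additivity, rational scaling and rational lengths\<close>

lemma phi_translate:
  assumes "x \<in> W" "v \<in> W"
  shows "\<forall>\<^sub>F f in U. f (x + v) - f x = phi f v"
  using transl_all[of v x] assms by (auto simp: transl_def phi_def add.commute dest: bspec[of _ _ 0])

lemma phi_add:
  assumes "x \<in> W" "y \<in> W"
  shows "\<forall>\<^sub>F f in U. phi f (x + y) = phi f x + phi f y"
  using phi_translate[OF assms] by eventually_elim (simp add: phi_def algebra_simps)

lemma phi_diff:
  assumes "x \<in> W" "y \<in> W"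
  shows "\<forall>\<^sub>F f in U. phi f (x - y) = phi f x - phi f y"
  using phi_add[OF W_diff[OF assms] assms(2)] by eventually_elim simp

lemma phi_of_nat:
  assumes "x \<in> W"
  shows "\<forall>\<^sub>F f in U. phi f (real k *\<^sub>R x) = real k *\<^sub>R phi f x"
proof (induction k)
  case (Suc k)
  have "\<forall>\<^sub>F f in U. phi f (real k *\<^sub>R x + x) = phi f (real k *\<^sub>R x) + phi f x"
    using assms by (intro phi_add W_intros) auto
  with Suc show ?case by eventually_elim (simp add: scaleR_left_distrib add.commute)
qed simp

lemma F_Rats:
  assumes "c \<in> \<rat>"
  shows "c \<in> F"
proof -
  obtain m k :: nat where "\<bar>c\<bar> = real m / real k" using Rats_abs_nat_div_natE[OF assms] by metis
  then have "c = real m / real k \<or> c = - (real m / real k)" by linarith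
  moreover have "real m / real k \<in> F" by (intro F_divide F_of_nat)
  ultimately show ?thesis by (elim disjE) (simp_all only: F_minus)
qed

lemma phi_Rats:
  assumes x: "x \<in> W" and c: "c \<in> \<rat>"
  shows "\<forall>\<^sub>F f in U. phi f (c *\<^sub>R x) = c *\<^sub>R phi f x"
proof -
  obtain m k :: nat where mk: "k \<noteq> 0" "\<bar>c\<bar> = real m / real k" using Rats_abs_nat_div_natE[OF c] by metis
  define y where "y = (real m / real k) *\<^sub>R x"
  have y: "y \<in> W" using x by (auto simp: y_def intro!: W_intros)
  have ky: "real k *\<^sub>R y = real m *\<^sub>R x" using mk by (simp add: y_def)
  have "\<forall>\<^sub>F f in U. phi f y = (real m / real k) *\<^sub>R phi f x"
    using phi_of_nat[OF x, of m] phi_of_nat[OF y, of k]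
  proof eventually_elim
    case (elim f)
    then have "real k *\<^sub>R phi f y = real m *\<^sub>R phi f x" by (simp add: ky)
    then have "(1 / real k) *\<^sub>R (real k *\<^sub>R phi f y) = (1 / real k) *\<^sub>R (real m *\<^sub>R phi f x)" by simp
    then show ?case using mk by simp
  qed
  moreover have "\<forall>\<^sub>F f in U. phi f (- y) = - phi f y" using phi_diff[OF W_0 y] by simp
  ultimately have "\<forall>\<^sub>F f in U. phi f y = (real m / real k) *\<^sub>R phi f x \<and> phi f (- y) = - phi f y"
    by (rule eventually_conj)
  moreover have "c *\<^sub>R x = y \<and> c = real m / real k \<or> c *\<^sub>R x = - y \<and> c = - (real m / real k)"
  proof -
    have "c = real m / real k \<or> c = - (real m / real k)" using mk by linarith
    then show ?thesis by (auto simp: y_def)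
  qed
  ultimately show ?thesis
    by (auto elim!: eventually_mono)
qed

lemma phi_unit:
  assumes "u \<in> W" "norm u = 1"
  shows "\<forall>\<^sub>F f in U. norm (phi f u) = 1"
  using U_unit[of 0 u] assms by (simp add: phi_def)

lemma phi_norm_Rats:
  assumes "v \<in> W" "norm v \<in> \<rat>"
  shows "\<forall>\<^sub>F f in U. norm (phi f v) = norm v"
proof (cases "v = 0")
  case False
  define u where "u = (1 / norm v) *\<^sub>R v"
  have u: "u \<in> W" "norm u = 1" "v = norm v *\<^sub>R u" using assms False by (auto simp: u_def intro!: W_intros)
  from phi_unit[OF u(1,2)] phi_Rats[OF u(1) assms(2)]
  show ?thesis by eventually_elim (simp flip: u(3))
qed simp

text \<open>A rational multiple of \<open>v\<close> has length between 1 and 2, where the endpoints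
  have distinct images.\<close>

lemma phi_nonzero:
  assumes "v \<in> W" "v \<noteq> 0"
  shows "\<forall>\<^sub>F f in U. phi f v \<noteq> 0"
proof -
  have "1 / norm v < 2 / norm v" using assms by (simp add: divide_strict_right_mono)
  then obtain c where c: "c \<in> \<rat>" "1 / norm v < c" "c < 2 / norm v" using Rats_dense_in_real by blast
  have "c > 0" using c(2) assms by (meson less_trans zero_less_divide_1_iff zero_less_norm_iff)
  then have "1 < norm (c *\<^sub>R v)" "norm (c *\<^sub>R v) < 2" using c assms \<open>c > 0\<close> by (auto simp: field_simps)
  then have "\<forall>\<^sub>F f in U. f (c *\<^sub>R v) \<noteq> f 0"
    using assms c F_Rats by (intro eventually_neq) (auto simp: W_intros)
  with phi_Rats[OF assms(1) c(1)] show ?thesis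
    by eventually_elim (auto simp: phi_def)
qed

text \<open>The diagonals of the rectangle on \<open>x\<close> and \<open>y\<close> share a rational
  length, which their images keep; a parallelogram with equal diagonals has a right angle.\<close>

lemma phi_orthogonal:
  assumes W: "x \<in> W" "y \<in> W" and "x \<bullet> y = 0" and "norm (x + y) \<in> \<rat>"
  shows "\<forall>\<^sub>F f in U. phi f x \<bullet> phi f y = 0"
proof -
  have n: "norm (x - y) = norm (x + y)"
    using assms(3) by (simp add: norm_eq inner_add_left inner_add_right inner_diff_left
        inner_diff_right inner_commute)
  have "\<forall>\<^sub>F f in U. norm (phi f (x + y)) = norm (x + y)" "\<forall>\<^sub>F f in U. norm (phi f (x - y)) = norm (x - y)"
    by (rule phi_norm_Rats; use assms n in \<open>simp add: W_intros\<close>)+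
  from this phi_add[OF W] phi_diff[OF W] show ?thesis
    by eventually_elim (rule norm_add_diff_orthogonal, simp add: n)
qed

subsection \<open>Lines through the origin\<close>

text \<open>Squares handle unit vectors; \<open>unit_sum\<close> splits \<open>r p\<close> into unit
  vectors in the plane of \<open>p\<close> and \<open>q\<close>, which are again orthogonal to
  \<open>e\<close>.\<close>

lemma phi_orthogonal_normal:
  assumes pq: "p \<in> W" "q \<in> W" "norm p = 1" "norm q = 1" "p \<bullet> q = 0"
    and e: "e \<in> W" "norm e = 1" "p \<bullet> e = 0" "q \<bullet> e = 0"
    and card3: "CARD('n) \<ge> 3" and r: "r \<in> F"
  shows "\<forall>\<^sub>F f in U. phi f (r *\<^sub>R p) \<bullet> phi f e = 0"
proof -
  obtain N x y a b where *: "r *\<^sub>R p = real N *\<^sub>R (x + y)" "x \<in> W" "y \<in> W" "norm x = 1" "norm y = 1"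
    "x = a *\<^sub>R p + b *\<^sub>R q" "y = a *\<^sub>R p - b *\<^sub>R q"
    using unit_sum[OF pq r] by metis
  have xe: "x \<bullet> e = 0" "y \<bullet> e = 0" using *(6,7) e(3,4) by (simp_all add: inner_add_left inner_diff_left)
  have "x + y \<in> W" by (rule W_add[OF *(2,3)])
  from eventually_square[OF card3 W_0 *(2) e(1) *(4) e(2) xe(1)]
    eventually_square[OF card3 W_0 *(3) e(1) *(5) e(2) xe(2)]
    phi_add[OF *(2,3)] phi_of_nat[OF this, of N]
  show ?thesis
  proof eventually_elim
    case (elim f)
    have "phi f x \<bullet> phi f e = 0" "phi f y \<bullet> phi f e = 0"
      using elim(1,2) by (simp_all add: phi_def)
    then show ?case unfolding *(1) elim(4) elim(3) by (simp add: inner_add_left)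
  qed
qed

lemma ex_common_leg:
  assumes a: "a \<in> F" and b: "b\<^sup>2 = a\<^sup>2 + 1"
  obtains s where "s \<in> F" "s > 0" "sqrt (a\<^sup>2 + s\<^sup>2) \<in> \<rat>" "sqrt (b\<^sup>2 + s\<^sup>2) \<in> \<rat>"
proof -
  obtain N :: nat where N: "2 * \<bar>a\<bar> + 1 < N" using reals_Archimedean2 by blast
  then have N1: "real N > 1" using abs_ge_zero[of a] by linarith
  \<comment> \<open>The hypotenuses must be rationals whose squares differ by
    \<open>b\<^sup>2 - a\<^sup>2 = 1\<close>; this pair does, and a large \<open>N\<close> makes
    \<open>d\<close> exceed the leg \<open>a\<close>.\<close>
  define d where "d = (real N - 1 / real N) / 2"
  define d' where "d' = (real N + 1 / real N) / 2"
  define w where "w = 1 / real N"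
  have "w < 1" using N1 by (simp add: w_def)
  then have "2 * \<bar>a\<bar> < real N - w" using N by simp
  then have d: "d > \<bar>a\<bar>" by (simp add: d_def w_def)
  then have d0: "d > 0" using abs_ge_zero[of a] by linarith
  have d'0: "d' > 0" using N1 by (simp add: d'_def add_pos_pos)
  have "d'\<^sup>2 - d\<^sup>2 = real N * (1 / real N)" unfolding d_def d'_def by (simp add: power2_eq_square field_simps)
  then have dd: "d'\<^sup>2 = d\<^sup>2 + 1" using N1 by simp
  have "\<bar>a\<bar>\<^sup>2 < d\<^sup>2" using d by (intro power_strict_mono) auto
  then have ad: "a\<^sup>2 < d\<^sup>2" by simp
  define s where "s = sqrt (d\<^sup>2 - a\<^sup>2)"
  have s: "s\<^sup>2 = d\<^sup>2 - a\<^sup>2" "s > 0" using ad by (simp_all add: s_def)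
  have "d \<in> \<rat>" "d' \<in> \<rat>" by (auto simp: d_def d'_def)
  moreover have "sqrt (a\<^sup>2 + s\<^sup>2) = d" "sqrt (b\<^sup>2 + s\<^sup>2) = d'"
  proof -
    have "a\<^sup>2 + s\<^sup>2 = d\<^sup>2" "b\<^sup>2 + s\<^sup>2 = d'\<^sup>2" using s dd b by auto
    then show "sqrt (a\<^sup>2 + s\<^sup>2) = d" "sqrt (b\<^sup>2 + s\<^sup>2) = d'" using d0 d'0 by simp_all
  qed
  moreover have "s \<in> F"
    unfolding s_def using a ad by (intro F_sqrt F_diff F_power F_Rats[OF \<open>d \<in> \<rat>\<close>]) auto
  ultimately show ?thesis using s(2) by (intro that) auto
qed

text \<open>With \<open>s\<close> from \<open>ex_common_leg\<close>, both \<open>a p\<close> and \<open>b p\<close> are perpendicular to \<open>s q\<close>, and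
  so are their images.\<close>

lemma phi_parallel_step:
  assumes pq: "p \<in> W" "q \<in> W" "norm p = 1" "norm q = 1" "p \<bullet> q = 0"
    and ab: "a \<in> F" "b \<in> F" "b \<noteq> 0" "b\<^sup>2 = a\<^sup>2 + 1 \<or> a\<^sup>2 = b\<^sup>2 + 1"
  shows "\<forall>\<^sub>F f in U. \<exists>c. phi f (a *\<^sub>R p) = c *\<^sub>R phi f (b *\<^sub>R p)"
proof -
  obtain s where s: "s \<in> F" "s > 0" "sqrt (a\<^sup>2 + s\<^sup>2) \<in> \<rat>" "sqrt (b\<^sup>2 + s\<^sup>2) \<in> \<rat>"
    using ab ex_common_leg by metis
  obtain i j :: 'n where ij: "i \<noteq> j" using ex_distinct_indices by blast
  obtain B where B: "B i = p" "B j = q" "\<And>k. B k \<in> W" "\<And>k. B k \<bullet> B k = 1"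
    "\<And>k l. k \<noteq> l \<Longrightarrow> B k \<bullet> B l = 0"
    using ex_frame[OF pq(1,3,2,4,5) ij] by metis
  have nB: "norm (B k) = 1" for k using B(4) by (simp add: norm_eq_1)
  have pqB: "p \<bullet> B k = 0" "q \<bullet> B k = 0" if "k \<notin> {i, j}" for k
    using B(5)[of i k] B(5)[of j k] that by (auto simp: B(1,2))
  have n: "norm (c *\<^sub>R p + s *\<^sub>R q) = sqrt (c\<^sup>2 + s\<^sup>2)" for c
    using pq by (simp add: norm_eq_sqrt_inner inner_add_left inner_add_right norm_eq_1
        inner_commute power2_eq_square)
  have o: "\<forall>\<^sub>F f in U. phi f (c *\<^sub>R p) \<bullet> phi f (s *\<^sub>R q) = 0" if "c \<in> F" "sqrt (c\<^sup>2 + s\<^sup>2) \<in> \<rat>" for c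
    using that pq s n by (intro phi_orthogonal) (auto intro: W_intros)
  have oB: "\<forall>\<^sub>F f in U. \<forall>k. k \<notin> {i, j} \<longrightarrow> phi f (c *\<^sub>R p) \<bullet> phi f (B k) = 0" if "c \<in> F" for c
    using that pq B(3) nB pqB card3[OF ij]
    by (intro eventually_finite_imp phi_orthogonal_normal[of p q]) auto
  have sB: "\<forall>\<^sub>F f in U. \<forall>k. k \<notin> {i, j} \<longrightarrow> phi f (s *\<^sub>R q) \<bullet> phi f (B k) = 0"
    using s pq B(3) nB pqB card3[OF ij]
    by (intro eventually_finite_imp phi_orthogonal_normal[of q p]) (auto simp: inner_commute)
  have BB: "\<forall>\<^sub>F f in U. \<forall>k l. k \<notin> {i, j} \<and> l \<notin> {i, j} \<and> k \<noteq> l \<longrightarrow> phi f (B k) \<bullet> phi f (B l) = 0"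
  proof (rule eventually_finite_imp2)
    fix k l assume kl: "k \<notin> {i, j} \<and> l \<notin> {i, j} \<and> k \<noteq> l"
    show "\<forall>\<^sub>F f in U. phi f (B k) \<bullet> phi f (B l) = 0"
      by (rule eventually_mono[OF eventually_square[of 0 "B k" "B l"]])
        (use card3[OF ij, of k] kl B nB in \<open>auto simp: phi_def\<close>)
  qed
  have Bn: "\<forall>\<^sub>F f in U. \<forall>k. norm (phi f (B k)) = 1"
    using B nB by (intro eventually_all_finite phi_unit) auto
  have "\<forall>\<^sub>F f in U. phi f (s *\<^sub>R q) \<noteq> 0" "\<forall>\<^sub>F f in U. phi f (b *\<^sub>R p) \<noteq> 0"
    using s pq ab by (auto intro!: phi_nonzero W_intros)
  from this o[OF ab(1) s(3)] o[OF ab(2) s(4)] oB[OF ab(1)] oB[OF ab(2)] sB BB Bn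
  show ?thesis
  proof eventually_elim
    case (elim f)
    define Y where "Y k = (if k = j then phi f (s *\<^sub>R q) else phi f (B k))" for k
    show ?case
    proof (rule parallel_if_orthogonal_family[where i = i and Y = Y])
      show "Y k \<noteq> 0" for k using elim(1,9) by (auto simp: Y_def) (metis norm_zero zero_neq_one)
      show "Y k \<bullet> Y l = 0" if "k \<noteq> l" "k \<noteq> i" "l \<noteq> i" for k l
        using that elim(7,8) by (auto simp: Y_def inner_commute)
      show "phi f (a *\<^sub>R p) \<bullet> Y k = 0" "phi f (b *\<^sub>R p) \<bullet> Y k = 0" if "k \<noteq> i" for k
        using that elim(3-6) by (auto simp: Y_def)
    qed (rule elim(2))
  qed
qed

text \<open>The reference scalar \<open>r\<close> stays fixed, so that the admissible
  \<open>c\<close> form a set with the closure properties below.\<close>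

definition par :: "real ^ 'n \<Rightarrow> real \<Rightarrow> real \<Rightarrow> bool" where
  "par p r c \<longleftrightarrow> c \<in> F \<and> (\<forall>\<^sub>F f in U. \<exists>t. phi f (c *\<^sub>R p) = t *\<^sub>R phi f (r *\<^sub>R p))"

lemma par_refl: "r \<in> F \<Longrightarrow> par p r r"
  unfolding par_def using exI[of "\<lambda>t. v = t *\<^sub>R v" 1 for v :: "real ^ 'n"] by simp

lemma par_add:
  assumes "p \<in> W" "par p r c" "par p r d"
  shows "par p r (c + d)"
proof -
  have F: "c \<in> F" "d \<in> F" using assms by (auto simp: par_def)
  have "\<forall>\<^sub>F f in U. phi f (c *\<^sub>R p + d *\<^sub>R p) = phi f (c *\<^sub>R p) + phi f (d *\<^sub>R p)"
    using assms F by (intro phi_add W_intros) auto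
  moreover have "\<forall>\<^sub>F f in U. \<exists>t. phi f (c *\<^sub>R p) = t *\<^sub>R phi f (r *\<^sub>R p)"
    "\<forall>\<^sub>F f in U. \<exists>t. phi f (d *\<^sub>R p) = t *\<^sub>R phi f (r *\<^sub>R p)"
    using assms by (auto simp: par_def)
  ultimately have "\<forall>\<^sub>F f in U. \<exists>t. phi f ((c + d) *\<^sub>R p) = t *\<^sub>R phi f (r *\<^sub>R p)"
    by eventually_elim (metis scaleR_add_left)
  then show ?thesis using F by (auto simp: par_def F_add)
qed

lemma par_mult:
  assumes "p \<in> W" "par p r c" "k \<in> \<rat>"
  shows "par p r (k * c)"
proof -
  have F: "c \<in> F" using assms by (auto simp: par_def)
  have "\<forall>\<^sub>F f in U. phi f (k *\<^sub>R (c *\<^sub>R p)) = k *\<^sub>R phi f (c *\<^sub>R p)"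
    using assms F by (intro phi_Rats W_intros) auto
  moreover have "\<forall>\<^sub>F f in U. \<exists>t. phi f (c *\<^sub>R p) = t *\<^sub>R phi f (r *\<^sub>R p)"
    using assms by (auto simp: par_def)
  ultimately have "\<forall>\<^sub>F f in U. \<exists>t. phi f ((k * c) *\<^sub>R p) = t *\<^sub>R phi f (r *\<^sub>R p)"
    by eventually_elim (metis scaleR_scaleR)
  then show ?thesis using F F_Rats[OF assms(3)] by (auto simp: par_def F_mult)
qed

lemma par_diff: "p \<in> W \<Longrightarrow> par p r c \<Longrightarrow> par p r d \<Longrightarrow> par p r (c - d)"
  using par_add[of p r c "- 1 * d"] par_mult[of p r d "- 1"] by simp

lemma par_trans:
  assumes "par p r c" "\<forall>\<^sub>F f in U. \<exists>t. phi f (d *\<^sub>R p) = t *\<^sub>R phi f (c *\<^sub>R p)" "d \<in> F"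
  shows "par p r d"
proof -
  have "\<forall>\<^sub>F f in U. \<exists>t. phi f (c *\<^sub>R p) = t *\<^sub>R phi f (r *\<^sub>R p)"
    using assms by (auto simp: par_def)
  with assms(2) have "\<forall>\<^sub>F f in U. \<exists>t. phi f (d *\<^sub>R p) = t *\<^sub>R phi f (r *\<^sub>R p)"
    by eventually_elim (metis scaleR_scaleR)
  then show ?thesis using assms(3) by (auto simp: par_def)
qed

lemma ex_unit_orthogonal:
  assumes "p \<in> W" "norm p = 1"
  obtains q where "q \<in> W" "norm q = 1" "p \<bullet> q = 0"
  using ex_orthonormal_pair[OF assms(1)] assms(2) by (metis scaleR_one)

lemma par_sqrt:
  assumes p: "p \<in> W" "norm p = 1" and c: "par p r c" "c \<noteq> 0" and d: "d \<in> F" "d\<^sup>2 = c\<^sup>2 + 1"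
  shows "par p r d"
proof -
  obtain q where "q \<in> W" "norm q = 1" "p \<bullet> q = 0" using ex_unit_orthogonal[OF p] .
  then show ?thesis
    using p c d by (intro par_trans[OF c(1)] phi_parallel_step[of p q]) (auto simp: par_def)
qed

text \<open>The numbers \<open>(c + 1/c)/2\<close> and \<open>(c - 1/c)/2\<close> have squares that differ by 1.\<close>

lemma par_inverse:
  assumes p: "p \<in> W" "norm p = 1" and c: "par p r c" "c \<noteq> 0"
  shows "par p r (1 / c)"
proof -
  have cF: "c \<in> F" using c by (simp add: par_def)
  define x y where "x = (c + 1 / c) / 2" and "y = (c - 1 / c) / 2"
  have F: "x \<in> F" "y \<in> F" "1 / c \<in> F" using cF by (auto simp: x_def y_def intro!: F_intros)
  have xy: "x + y = c" "x - y = 1 / c" by (simp_all add: x_def y_def field_simps)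
  have sq: "x\<^sup>2 = y\<^sup>2 + 1" using c by (simp add: x_def y_def power2_eq_square field_simps)
  show ?thesis
  proof (cases "y = 0")
    \<comment> \<open>Here \<open>c = 1 / c\<close>, and \<open>y\<close> could not serve as
      reference in the parallel step.\<close>
    case True
    then show ?thesis using xy c by simp
  next
    case False
    obtain q where q: "q \<in> W" "norm q = 1" "p \<bullet> q = 0" using ex_unit_orthogonal[OF p] .
    have 1: "\<forall>\<^sub>F f in U. \<exists>t. phi f (x *\<^sub>R p) = t *\<^sub>R phi f (y *\<^sub>R p)"
      using p q F False sq by (intro phi_parallel_step[of p q]) auto
    have xyW: "x *\<^sub>R p \<in> W" "y *\<^sub>R p \<in> W" "c *\<^sub>R p \<in> W" using p F cF by (auto intro: W_intros)
    have 2: "\<forall>\<^sub>F f in U. phi f (c *\<^sub>R p) \<noteq> 0"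
      using c p xyW by (intro phi_nonzero) auto
    from 1 2 phi_add[OF xyW(1,2)] phi_diff[OF xyW(1,2)]
    have "\<forall>\<^sub>F f in U. \<exists>t. phi f ((1 / c) *\<^sub>R p) = t *\<^sub>R phi f (c *\<^sub>R p)"
    proof eventually_elim
      case (elim f)
      obtain t where t: "phi f (x *\<^sub>R p) = t *\<^sub>R phi f (y *\<^sub>R p)" using elim(1) by blast
      have "phi f (c *\<^sub>R p) = (t + 1) *\<^sub>R phi f (y *\<^sub>R p)"
        using elim(3) t xy(1) by (simp add: scaleR_add_left flip: scaleR_add_left[of x y p])
      moreover have "phi f ((1 / c) *\<^sub>R p) = (t - 1) *\<^sub>R phi f (y *\<^sub>R p)"
        using elim(4) t xy(2) by (simp add: scaleR_diff_left flip: scaleR_diff_left[of x y p])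
      moreover from calculation(1) have "t + 1 \<noteq> 0" using elim(2) by auto
      ultimately have "phi f ((1 / c) *\<^sub>R p) = ((t - 1) / (t + 1)) *\<^sub>R phi f (c *\<^sub>R p)" by simp
      then show ?case ..
    qed
    then show ?thesis by (rule par_trans[OF c(1) _ F(3)])
  qed
qed

text \<open>
  Parametrising \<open>e\<^sup>2 = t\<^sup>2 + 1\<close> by \<open>t = 2mr/(m\<^sup>2 - r\<^sup>2)\<close>, an odd function of \<open>r\<close>, gives the
  even function \<open>e = (m\<^sup>2 + r\<^sup>2)/(m\<^sup>2 - r\<^sup>2)\<close>.
\<close>

lemma par_even:
  assumes p: "p \<in> W" "norm p = 1" and r: "r \<in> F" "0 < r" "r < 1" and m: "m \<ge> 1" "m \<in> \<rat>"
  shows "par p r ((m\<^sup>2 + r\<^sup>2) / (m\<^sup>2 - r\<^sup>2))"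
proof -
  have mF: "m \<in> F" using m F_Rats by auto
  have "r\<^sup>2 < m\<^sup>2" using r m by (intro power_strict_mono) auto
  then have pos: "m\<^sup>2 - r\<^sup>2 > 0" by simp
  \<comment> \<open>Up to the factor \<open>2 m\<close>, the odd function is the inverse of this
    combination.\<close>
  have "par p r (m\<^sup>2 * (1 / r) - r)"
    using p r m by (intro par_diff par_mult par_inverse par_refl) auto
  moreover have eq: "m\<^sup>2 * (1 / r) - r = (m\<^sup>2 - r\<^sup>2) / r"
    using r by (simp add: power2_eq_square divide_simps)
  ultimately have "par p r (2 * m * (1 / ((m\<^sup>2 - r\<^sup>2) / r)))"
    using p r m pos by (intro par_mult par_inverse) auto
  then have t: "par p r (2 * m * r / (m\<^sup>2 - r\<^sup>2))" by simp
  have e: "((m\<^sup>2 + r\<^sup>2) / (m\<^sup>2 - r\<^sup>2))\<^sup>2 = (2 * m * r / (m\<^sup>2 - r\<^sup>2))\<^sup>2 + 1"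
  proof -
    have "(m\<^sup>2 + r\<^sup>2)\<^sup>2 = (2 * m * r)\<^sup>2 + (m\<^sup>2 - r\<^sup>2)\<^sup>2" by (simp add: power2_eq_square algebra_simps)
    then show ?thesis using pos by (simp add: power_divide add_divide_distrib[of _ "(m\<^sup>2 - r\<^sup>2)\<^sup>2"])
  qed
  show ?thesis
    by (rule par_sqrt[OF p t _ _ e]) (use r m pos mF in \<open>auto intro!: F_intros\<close>)
qed

text \<open>
  Up to constant factors, \<open>1 / (e j - e k)\<close> is \<open>r\<^sup>2 - (j\<^sup>2 + k\<^sup>2) + j\<^sup>2 k\<^sup>2 / r\<^sup>2\<close>; as
  \<open>1 * 6 = 2 * 3\<close>, the pairs (1, 6) and (2, 3) differ only in the constant term.
\<close>

lemma par_1: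
  assumes p: "p \<in> W" "norm p = 1" and r: "r \<in> F" "0 < r" "r < 1"
  shows "par p r 1"
proof -
  define e where "e m = (m\<^sup>2 + r\<^sup>2) / (m\<^sup>2 - r\<^sup>2)" for m :: real
  have e: "par p r (e m)" if "m \<ge> 1" "m \<in> \<rat>" for m
    unfolding e_def by (rule par_even[OF p r that])
  define R where "R = r\<^sup>2"
  have R: "0 < R" "R < 1" using r by (simp_all add: R_def power_less_one_iff)
  have e16: "e 1 - e 6 = 70 * R / ((1 - R) * (36 - R))"
    using R by (simp add: e_def R_def[symmetric] divide_simps) (simp add: algebra_simps)
  have e23: "e 2 - e 3 = 10 * R / ((4 - R) * (9 - R))"
    using R by (simp add: e_def R_def[symmetric] divide_simps) (simp add: algebra_simps)
  have "e 1 - e 6 \<noteq> 0" "e 2 - e 3 \<noteq> 0" unfolding e16 e23 using R by auto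
  \<comment> \<open>The two terms are \<open>R - 37 + 36 / R\<close> and
    \<open>R - 13 + 36 / R\<close>, so their difference is -24.\<close>
  then have "par p r (- (1 / 24) * (70 * (1 / (e 1 - e 6)) - 10 * (1 / (e 2 - e 3))))"
    using p by (intro par_mult par_diff par_inverse e) auto
  moreover have "70 * (1 / (e 1 - e 6)) - 10 * (1 / (e 2 - e 3)) = - 24"
    unfolding e16 e23 using R by (simp add: divide_simps) (simp add: algebra_simps)
  ultimately show ?thesis by simp
qed

text \<open>\<open>par_1\<close> puts \<open>phi f p\<close> on the line of
  \<open>phi f (r' p)\<close> for a small \<open>r'\<close>; as \<open>phi f p\<close> is nonzero
  the relation reverses, and a rational factor restores \<open>r\<close>.\<close>

lemma phi_parallel:
  assumes p: "p \<in> W" "norm p = 1" and r: "r \<in> F"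
  shows "\<forall>\<^sub>F f in U. \<exists>t. phi f (r *\<^sub>R p) = t *\<^sub>R phi f p"
proof (cases "r = 0")
  case False
  obtain N :: nat where N: "\<bar>r\<bar> < N" using reals_Archimedean2 by blast
  then have N0: "real N > 0" using abs_ge_zero[of r] by linarith
  define r' where "r' = \<bar>r\<bar> / N"
  have "\<bar>r\<bar> \<in> F" using r by (auto simp: abs_if F_minus)
  then have r': "r' \<in> F" "0 < r'" "r' < 1"
    using N N0 False by (auto simp: r'_def intro!: F_intros)
  have "par p 1 r'"
  proof -
    have "\<forall>\<^sub>F f in U. \<exists>t. phi f p = t *\<^sub>R phi f (r' *\<^sub>R p)"
      using par_1[OF p r'] by (simp add: par_def)
    moreover have "\<forall>\<^sub>F f in U. phi f p \<noteq> 0" using p by (intro phi_nonzero) auto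
    ultimately have "\<forall>\<^sub>F f in U. \<exists>t. phi f (r' *\<^sub>R p) = t *\<^sub>R phi f p"
    proof eventually_elim
      case (elim f)
      then obtain t where t: "phi f p = t *\<^sub>R phi f (r' *\<^sub>R p)" "t \<noteq> 0" by auto
      then have "phi f (r' *\<^sub>R p) = (1 / t) *\<^sub>R phi f p" by simp
      then show ?case ..
    qed
    then show ?thesis using r' by (simp add: par_def)
  qed
  then have "par p 1 ((sgn r * N) * r')"
    using p by (intro par_mult) (auto simp: sgn_if)
  moreover have "(sgn r * N) * r' = r" using N0 by (simp add: r'_def sgn_mult_abs)
  ultimately show ?thesis by (simp add: par_def)
qed (auto intro: always_eventually exI[of _ 0])

lemma phi_norm_eq:
  assumes W: "a \<in> W" "b \<in> W" and ab: "norm a = norm b"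
  shows "\<forall>\<^sub>F f in U. norm (phi f a) = norm (phi f b)"
proof -
  define x y where "x = (1 / 2) *\<^sub>R (a + b)" and "y = (1 / 2) *\<^sub>R (a - b)"
  have xyW: "x \<in> W" "y \<in> W" using W by (auto simp: x_def y_def intro!: W_intros)
  have xy: "x + y = a" "x - y = b" by (simp_all add: x_def y_def algebra_simps flip: scaleR_add_left)
  have "x \<bullet> y = 0"
    using ab by (intro norm_add_diff_orthogonal) (simp add: xy)
  have "\<forall>\<^sub>F f in U. phi f x \<bullet> phi f y = 0"
  proof (cases "x = 0 \<or> y = 0")
    case True
    then show ?thesis by auto
  next
    case False
    define p q where "p = (1 / norm x) *\<^sub>R x" and "q = (1 / norm y) *\<^sub>R y"
    have pq: "p \<in> W" "q \<in> W" "norm p = 1" "norm q = 1" "p \<bullet> q = 0"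
      using False xyW \<open>x \<bullet> y = 0\<close> by (auto simp: p_def q_def intro!: W_intros)
    have x: "x = norm x *\<^sub>R p" and y: "y = norm y *\<^sub>R q" using False by (auto simp: p_def q_def)
    \<comment> \<open>A 3-4-5 triangle has rational sides, so \<open>phi f p\<close> and
      \<open>phi f q\<close> are orthogonal; \<open>phi_parallel\<close> carries this over to
      \<open>x\<close> and \<open>y\<close>.\<close>
    have "norm ((3 / 5) *\<^sub>R p + (4 / 5) *\<^sub>R q) = 1"
      using pq(3-5) unfolding norm_eq_1 by (simp add: inner_add_left inner_add_right inner_commute)
    then have "\<forall>\<^sub>F f in U. phi f ((3 / 5) *\<^sub>R p) \<bullet> phi f ((4 / 5) *\<^sub>R q) = 0"
      using pq by (intro phi_orthogonal) (auto intro!: W_intros)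
    moreover have "\<forall>\<^sub>F f in U. phi f ((3 / 5) *\<^sub>R p) = (3 / 5) *\<^sub>R phi f p"
      "\<forall>\<^sub>F f in U. phi f ((4 / 5) *\<^sub>R q) = (4 / 5) *\<^sub>R phi f q"
      using pq by (auto intro!: phi_Rats)
    moreover note phi_parallel[OF pq(1,3) F_norm[OF xyW(1)]] phi_parallel[OF pq(2,4) F_norm[OF xyW(2)]]
    ultimately show ?thesis
      by eventually_elim (auto simp flip: x y)
  qed
  with phi_add[OF xyW] phi_diff[OF xyW] show ?thesis
    by eventually_elim (simp add: xy norm_eq inner_add_left inner_add_right inner_diff_left
        inner_diff_right inner_commute)
qed

lemma equidistance_forced:
  assumes W: "J \<in> W" "K \<in> W" "L \<in> W" "M \<in> W" and eq: "dist J K = dist L M"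
  shows "\<exists>C. finite C \<and> {J, K, L, M} \<subseteq> C \<and> C \<subseteq> W \<and>
    (\<forall>f. preserves_unit_distance_on C f \<longrightarrow> dist (f J) (f K) = dist (f L) (f M))"
proof -
  have d: "K - J \<in> W" "M - L \<in> W" using W by (auto intro: W_intros)
  have "norm (K - J) = norm (M - L)" using eq by (simp add: dist_norm norm_minus_commute)
  from phi_norm_eq[OF d this] phi_translate[OF W(1) d(1)] phi_translate[OF W(3) d(2)]
  have "\<forall>\<^sub>F f in U. dist (f J) (f K) = dist (f L) (f M)"
    by eventually_elim (simp add: dist_norm norm_minus_commute[of "f J" for f]
        norm_minus_commute[of "f L" for f])
  then obtain C where C: "finite C" "C \<subseteq> W"
    "\<And>f. preserves_unit_distance_on C f \<Longrightarrow> dist (f J) (f K) = dist (f L) (f M)"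
    using eventually_U_finite by blast
  \<comment> \<open>Adding the four points to \<open>C\<close> only strengthens the assumption on
    \<open>f\<close>.\<close>
  then show ?thesis
    using W by (intro exI[of _ "C \<union> {J, K, L, M}"]) (auto simp: preserves_unit_distance_on_def)
qed

end

section \<open>The two fields: all reals and the constructible numbers\<close>

lemma sqrt_closed_points_UNIV:
  assumes "CARD('n) \<ge> 2"
  shows "sqrt_closed_points UNIV (UNIV :: (real ^ 'n) set)"
  using assms by (intro sqrt_closed_points.intro) simp_all

lemma sqrt_closed_points_constructible:
  assumes "CARD('n) \<ge> 2"
  shows "sqrt_closed_points constructible (constructible_points :: (real ^ 'n) set)"
  using assms
  by (intro sqrt_closed_points.intro) (simp_all add: constructible_points_def constructible.intros)

theorem theorem4:
  fixes J K L M :: "real ^ 'n"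
  assumes "CARD('n) > 1"
    and "dist J K = dist L M"
  shows "(\<exists>C :: (real ^ 'n) set. finite C \<and> {J, K, L, M} \<subseteq> C \<and>
            (\<forall>f. preserves_unit_distance_on C f \<longrightarrow> dist (f J) (f K) = dist (f L) (f M))) \<and>
         ({J, K, L, M} \<subseteq> constructible_points \<longrightarrow>
          (\<exists>C :: (real ^ 'n) set. finite C \<and> {J, K, L, M} \<subseteq> C \<and> C \<subseteq> constructible_points \<and>
            (\<forall>f. preserves_unit_distance_on C f \<longrightarrow> dist (f J) (f K) = dist (f L) (f M))))"
proof (intro conjI impI)
  have card: "CARD('n) \<ge> 2" using assms(1) by simp
  show "\<exists>C :: (real ^ 'n) set. finite C \<and> {J, K, L, M} \<subseteq> C \<and>
    (\<forall>f. preserves_unit_distance_on C f \<longrightarrow> dist (f J) (f K) = dist (f L) (f M))"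
    using sqrt_closed_points.equidistance_forced[OF sqrt_closed_points_UNIV[OF card], of J K L M]
      assms(2) by auto
  assume "{J, K, L, M} \<subseteq> constructible_points"
  then show "\<exists>C :: (real ^ 'n) set. finite C \<and> {J, K, L, M} \<subseteq> C \<and> C \<subseteq> constructible_points \<and>
    (\<forall>f. preserves_unit_distance_on C f \<longrightarrow> dist (f J) (f K) = dist (f L) (f M))"
    by (intro sqrt_closed_points.equidistance_forced[OF sqrt_closed_points_constructible[OF card]]
        assms(2)) auto
qed

end
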